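(* Let $\phi:(M^m,g)\to (N,h)$ be a non-minimal Riemannian immersion, with biharmonic stress-energy tensor $S_2$. Then $S_2=\lambda g$ for some constant $\lambda\in\mathbb{R}$ if and only if $\phi$ is pseudo-umbilical and, if $m\neq 4$, the norm of $\tau(\phi)$ is constant.
   Context: All manifolds, metrics and maps are smooth; manifolds are connected and without boundary. For a map $\phi:(M^m,g)\to(N,h)$, the tension field is $\tau(\phi)=\operatorname{trace}_g\nabla d\phi$, a section of $\phi^{-1}TN$, and the biharmonic stress-energy tensor is the symmetric $(0,2)$-tensor field on $M$ $$S_2(X,Y)=\tfrac12|\tau(\phi)|^2\langle X,Y\rangle+\langle d\phi,\nabla\tau(\phi)\rangle\langle X,Y\rangle-\langle d\phi(X),\nabla_Y\tau(\phi)\rangle-\langle d\phi(Y),\nabla_X\tau(\phi)\rangle,$$ where $\nabla\tau(\phi)$ uses the pull-back connection on $\phi^{-1}TN$ and $\langle d\phi,\nabla\tau(\phi)\rangle=\sum_i\langle d\phi(e_i),\nabla_{e_i}\tau(\phi)\rangle$ for a local orthonormal frame $\{e_i\}$. A Riemannian immersion is an immersion with $g=\phi^*h$; it is minimal if $\tau(\phi)=0$ identically. With second fundamental form $B=\nabla d\phi$, it is pseudo-umbilical if $\langle B(X,Y),\tau(\phi)\rangle=\frac1m|\tau(\phi)|^2\langle X,Y\rangle$ for all vector fields $X,Y$ on $M$. *)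

theory Defs
  imports "HOL-Analysis.Analysis"
begin

section \<open>Smooth functions between open subsets of Euclidean spaces\<close>

text \<open>The set \<open>S\<close> is always meant to be open.\<close>

fun Ck_on :: "nat \<Rightarrow> 'e::euclidean_space set \<Rightarrow> ('e \<Rightarrow> 'f::euclidean_space) \<Rightarrow> bool" where
  "Ck_on 0 S f \<longleftrightarrow> continuous_on S f"
| "Ck_on (Suc k) S f \<longleftrightarrow>
     (\<forall>x\<in>S. f differentiable (at x)) \<and>
     (\<forall>v. Ck_on k S (\<lambda>x. frechet_derivative f (at x) v))"

definition smooth_on :: "'e::euclidean_space set \<Rightarrow> ('e \<Rightarrow> 'f::euclidean_space) \<Rightarrow> bool" where
  "smooth_on S f \<longleftrightarrow> (\<forall>k. Ck_on k S f)"


section \<open>Smooth manifolds\<close>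

text \<open>A chart is a pair of a domain and a coordinate map. The dimension of a manifold is
  \<open>CARD('m)\<close>. A tangent vector at \<open>p\<close> is the family of its coordinate
  vectors in all charts of the atlas around \<open>p\<close>, transforming by the derivatives of the
  transition maps. The components at all other (irrelevant) charts are set to 0, which makes
  \<open>tangent_space M p\<close> below a vector space of dimension \<open>CARD('m)\<close> under the
  pointwise operations.\<close>

type_synonym ('a, 'm) chart = "'a set \<times> ('a \<Rightarrow> real^'m)"

type_synonym ('a, 'm) tvec = "('a, 'm) chart \<Rightarrow> real^'m"

record ('a, 'm) manifold =
  carrier_top :: "'a topology"
  atlas :: "('a, 'm::finite) chart set"
  metric :: "'a \<Rightarrow> ('a, 'm) tvec \<Rightarrow> ('a, 'm) tvec \<Rightarrow> real"

abbreviation points :: "('a, 'm::finite) manifold \<Rightarrow> 'a set" where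
  "points M \<equiv> topspace (carrier_top M)"

definition chart_inv :: "('a, 'm::finite) chart \<Rightarrow> real^'m \<Rightarrow> 'a" where
  "chart_inv c = inv_into (fst c) (snd c)"

definition is_chart :: "'a topology \<Rightarrow> ('a, 'm::finite) chart \<Rightarrow> bool" where
  "is_chart X c \<longleftrightarrow> openin X (fst c) \<and> open (snd c ` fst c) \<and>
     homeomorphic_map (subtopology X (fst c)) (top_of_set (snd c ` fst c)) (snd c)"

definition smooth_manifold :: "('a, 'm::finite) manifold \<Rightarrow> bool" where
  "smooth_manifold M \<longleftrightarrow>
     Hausdorff_space (carrier_top M) \<and> second_countable (carrier_top M) \<and>
     connected_space (carrier_top M) \<and>
     (\<forall>c\<in>atlas M. is_chart (carrier_top M) c) \<and>
     (\<Union>c\<in>atlas M. fst c) = points M \<and>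
     (\<forall>c\<in>atlas M. \<forall>c'\<in>atlas M.
        smooth_on (snd c ` (fst c \<inter> fst c')) (snd c' \<circ> chart_inv c))"

definition charts_at :: "('a, 'm::finite) manifold \<Rightarrow> 'a \<Rightarrow> ('a, 'm) chart set" where
  "charts_at M p = {c \<in> atlas M. p \<in> fst c}"

definition chart_at :: "('a, 'm::finite) manifold \<Rightarrow> 'a \<Rightarrow> ('a, 'm) chart" where
  "chart_at M p = (SOME c. c \<in> charts_at M p)"

definition tangent_space :: "('a, 'm::finite) manifold \<Rightarrow> 'a \<Rightarrow> ('a, 'm) tvec set" where
  "tangent_space M p = {v.
     (\<forall>c\<in>charts_at M p. \<forall>c'\<in>charts_at M p.
        v c' = frechet_derivative (snd c' \<circ> chart_inv c) (at (snd c p)) (v c)) \<and>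
     (\<forall>c. c \<notin> charts_at M p \<longrightarrow> v c = 0)}"

text \<open>The tangent vector at \<open>p\<close> whose coordinate vector in the chart \<open>c\<close> is \<open>a\<close>.\<close>

definition coord_vec :: "('a, 'm::finite) manifold \<Rightarrow> ('a, 'm) chart \<Rightarrow> 'a \<Rightarrow> real^'m \<Rightarrow> ('a, 'm) tvec" where
  "coord_vec M c p a = (\<lambda>c'. if c' \<in> charts_at M p
     then frechet_derivative (snd c' \<circ> chart_inv c) (at (snd c p)) a else 0)"

text \<open>The derivative of a function \<open>f\<close> (defined near \<open>p\<close>) along \<open>v\<close>; the
  value does not depend on the chart used to express it.\<close>

definition dir_deriv :: "('a, 'm::finite) manifold \<Rightarrow> 'a \<Rightarrow> ('a, 'm) tvec \<Rightarrow> ('a \<Rightarrow> 'f::real_normed_vector) \<Rightarrow> 'f" where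
  "dir_deriv M p v f =
     (let c = chart_at M p in frechet_derivative (f \<circ> chart_inv c) (at (snd c p)) (v c))"

definition smooth_map ::
  "('a, 'm::finite) manifold \<Rightarrow> ('b, 'n::finite) manifold \<Rightarrow> ('a \<Rightarrow> 'b) \<Rightarrow> bool" where
  "smooth_map M N \<phi> \<longleftrightarrow> continuous_map (carrier_top M) (carrier_top N) \<phi> \<and>
     (\<forall>c\<in>atlas M. \<forall>d\<in>atlas N.
        smooth_on (snd c ` {p \<in> fst c. \<phi> p \<in> fst d}) (snd d \<circ> \<phi> \<circ> chart_inv c))"

definition differential ::
  "('a, 'm::finite) manifold \<Rightarrow> ('b, 'n::finite) manifold \<Rightarrow> ('a \<Rightarrow> 'b) \<Rightarrow> 'a \<Rightarrow> ('a, 'm) tvec \<Rightarrow> ('b, 'n) tvec" where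
  "differential M N \<phi> p v =
     (\<lambda>d. if d \<in> charts_at N (\<phi> p) then dir_deriv M p v (snd d \<circ> \<phi>) else 0)"


section \<open>Riemannian manifolds\<close>

text \<open>The metric in the chart \<open>c\<close>, at the point with coordinates \<open>x\<close>.\<close>

definition metric_coord :: "('a, 'm::finite) manifold \<Rightarrow> ('a, 'm) chart \<Rightarrow> real^'m \<Rightarrow> real^'m \<Rightarrow> real^'m \<Rightarrow> real" where
  "metric_coord M c x a b =
     metric M (chart_inv c x) (coord_vec M c (chart_inv c x) a) (coord_vec M c (chart_inv c x) b)"

definition riemannian_manifold :: "('a, 'm::finite) manifold \<Rightarrow> bool" where
  "riemannian_manifold M \<longleftrightarrow> smooth_manifold M \<and>
     (\<forall>p\<in>points M. \<forall>u\<in>tangent_space M p. \<forall>v\<in>tangent_space M p.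
        metric M p u v = metric M p v u \<and>
        (\<forall>w\<in>tangent_space M p. \<forall>r.
           metric M p (\<lambda>c. r *\<^sub>R u c + v c) w = r * metric M p u w + metric M p v w)) \<and>
     (\<forall>p\<in>points M. \<forall>u\<in>tangent_space M p. u \<noteq> (\<lambda>_. 0) \<longrightarrow> metric M p u u > 0) \<and>
     (\<forall>c\<in>atlas M. \<forall>a b.
        smooth_on (snd c ` fst c)
          (\<lambda>x. metric_coord M c x a b))"

text \<open>An orthonormal basis of the tangent space at \<open>p\<close>; the traces formed with it below
  do not depend on the choice.\<close>

definition is_onb :: "('a, 'm::finite) manifold \<Rightarrow> 'a \<Rightarrow> ('m \<Rightarrow> ('a, 'm) tvec) \<Rightarrow> bool" where
  "is_onb M p e \<longleftrightarrow> (\<forall>i. e i \<in> tangent_space M p) \<and>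
     (\<forall>i j. metric M p (e i) (e j) = (if i = j then 1 else 0))"

definition onb :: "('a, 'm::finite) manifold \<Rightarrow> 'a \<Rightarrow> 'm \<Rightarrow> ('a, 'm) tvec" where
  "onb M p = (SOME e. is_onb M p e)"

text \<open>The Levi-Civita connection is given by the Koszul formula. For the vector fields with
  constant coordinates \<open>a\<close>, \<open>b\<close>, \<open>w\<close> in the chart \<open>c\<close> all Lie brackets vanish and
  it reads \<open>2 g(\<nabla>\<^sub>a b, w) = a g(b, w) + b g(a, w) - w g(a, b)\<close>; \<open>christoffel M c p a b\<close>
  is the coordinate vector of \<open>\<nabla>\<^sub>a b\<close> at \<open>p\<close>, i.e. its \<open>k\<close>-th component is the sum of
  the \<open>\<Gamma>\<^sup>k\<^sub>i\<^sub>j a\<^sub>i b\<^sub>j\<close>.\<close>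

definition christoffel :: "('a, 'm::finite) manifold \<Rightarrow> ('a, 'm) chart \<Rightarrow> 'a \<Rightarrow> real^'m \<Rightarrow> real^'m \<Rightarrow> real^'m" where
  "christoffel M c p a b = (THE z. \<forall>w.
     2 * metric_coord M c (snd c p) z w =
       frechet_derivative (\<lambda>x. metric_coord M c x b w) (at (snd c p)) a
     + frechet_derivative (\<lambda>x. metric_coord M c x a w) (at (snd c p)) b
     - frechet_derivative (\<lambda>x. metric_coord M c x a b) (at (snd c p)) w)"

definition levi_civita ::
  "('a, 'm::finite) manifold \<Rightarrow> 'a \<Rightarrow> ('a, 'm) tvec \<Rightarrow> ('a \<Rightarrow> ('a, 'm) tvec) \<Rightarrow> ('a, 'm) tvec" where
  "levi_civita M p v Y = (\<lambda>c. if c \<in> charts_at M p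
     then dir_deriv M p v (\<lambda>q. Y q c) + christoffel M c p (v c) (Y p c) else 0)"

text \<open>The pull-back connection on \<open>\<phi>\<^sup>-\<^sup>1TN\<close>, applied to a section \<open>V\<close> along \<open>\<phi>\<close>.\<close>

definition pullback_conn ::
  "('a, 'm::finite) manifold \<Rightarrow> ('b, 'n::finite) manifold \<Rightarrow> ('a \<Rightarrow> 'b) \<Rightarrow> 'a \<Rightarrow> ('a, 'm) tvec
     \<Rightarrow> ('a \<Rightarrow> ('b, 'n) tvec) \<Rightarrow> ('b, 'n) tvec" where
  "pullback_conn M N \<phi> p v V = (\<lambda>d. if d \<in> charts_at N (\<phi> p)
     then dir_deriv M p v (\<lambda>q. V q d) + christoffel N d (\<phi> p) (differential M N \<phi> p v d) (V p d)
     else 0)"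


section \<open>Tension field and biharmonic stress-energy tensor\<close>

text \<open>The second fundamental form
  \<open>(\<nabla>d\<phi>)(X, Y) = \<nabla>\<^sup>\<phi>\<^sub>X (d\<phi>(Y)) - d\<phi>(\<nabla>\<^sub>X Y)\<close> of \<open>\<phi>\<close>. It is tensorial, so at a point \<open>p\<close>
  it is evaluated on tangent vectors \<open>u\<close>, \<open>v\<close> by extending \<open>v\<close> to the local vector field
  \<open>Y\<close> with constant coordinates in some chart around \<open>p\<close>.\<close>

definition second_fund ::
  "('a, 'm::finite) manifold \<Rightarrow> ('b, 'n::finite) manifold \<Rightarrow> ('a \<Rightarrow> 'b) \<Rightarrow> 'a
     \<Rightarrow> ('a, 'm) tvec \<Rightarrow> ('a, 'm) tvec \<Rightarrow> ('b, 'n) tvec" where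
  "second_fund M N \<phi> p u v =
     (let c = chart_at M p; Y = (\<lambda>q. coord_vec M c q (v c)) in
      (\<lambda>d. pullback_conn M N \<phi> p u (\<lambda>q. differential M N \<phi> q (Y q)) d
          - differential M N \<phi> p (levi_civita M p u Y) d))"

definition tension ::
  "('a, 'm::finite) manifold \<Rightarrow> ('b, 'n::finite) manifold \<Rightarrow> ('a \<Rightarrow> 'b) \<Rightarrow> 'a \<Rightarrow> ('b, 'n) tvec" where
  "tension M N \<phi> p = (\<lambda>d. \<Sum>i\<in>UNIV. second_fund M N \<phi> p (onb M p i) (onb M p i) d)"

definition tension_norm ::
  "('a, 'm::finite) manifold \<Rightarrow> ('b, 'n::finite) manifold \<Rightarrow> ('a \<Rightarrow> 'b) \<Rightarrow> 'a \<Rightarrow> real" where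
  "tension_norm M N \<phi> p = sqrt (metric N (\<phi> p) (tension M N \<phi> p) (tension M N \<phi> p))"

definition nabla_tension ::
  "('a, 'm::finite) manifold \<Rightarrow> ('b, 'n::finite) manifold \<Rightarrow> ('a \<Rightarrow> 'b) \<Rightarrow> 'a \<Rightarrow> ('a, 'm) tvec \<Rightarrow> ('b, 'n) tvec" where
  "nabla_tension M N \<phi> p v = pullback_conn M N \<phi> p v (tension M N \<phi>)"

definition stress_energy2 ::
  "('a, 'm::finite) manifold \<Rightarrow> ('b, 'n::finite) manifold \<Rightarrow> ('a \<Rightarrow> 'b) \<Rightarrow> 'a
     \<Rightarrow> ('a, 'm) tvec \<Rightarrow> ('a, 'm) tvec \<Rightarrow> real" where
  "stress_energy2 M N \<phi> p X Y =
     1/2 * (tension_norm M N \<phi> p)\<^sup>2 * metric M p X Y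
   + (\<Sum>i\<in>UNIV. metric N (\<phi> p) (differential M N \<phi> p (onb M p i)) (nabla_tension M N \<phi> p (onb M p i)))
       * metric M p X Y
   - metric N (\<phi> p) (differential M N \<phi> p X) (nabla_tension M N \<phi> p Y)
   - metric N (\<phi> p) (differential M N \<phi> p Y) (nabla_tension M N \<phi> p X)"


section \<open>Riemannian immersions\<close>

definition riemannian_immersion ::
  "('a, 'm::finite) manifold \<Rightarrow> ('b, 'n::finite) manifold \<Rightarrow> ('a \<Rightarrow> 'b) \<Rightarrow> bool" where
  "riemannian_immersion M N \<phi> \<longleftrightarrow> smooth_map M N \<phi> \<and>
     (\<forall>p\<in>points M. inj_on (differential M N \<phi> p) (tangent_space M p) \<and>
        (\<forall>u\<in>tangent_space M p. \<forall>v\<in>tangent_space M p.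
           metric M p u v = metric N (\<phi> p) (differential M N \<phi> p u) (differential M N \<phi> p v)))"

definition minimal ::
  "('a, 'm::finite) manifold \<Rightarrow> ('b, 'n::finite) manifold \<Rightarrow> ('a \<Rightarrow> 'b) \<Rightarrow> bool" where
  "minimal M N \<phi> \<longleftrightarrow> (\<forall>p\<in>points M. tension M N \<phi> p = (\<lambda>_. 0))"

definition pseudo_umbilical ::
  "('a, 'm::finite) manifold \<Rightarrow> ('b, 'n::finite) manifold \<Rightarrow> ('a \<Rightarrow> 'b) \<Rightarrow> bool" where
  "pseudo_umbilical M N \<phi> \<longleftrightarrow>
     (\<forall>p\<in>points M. \<forall>X\<in>tangent_space M p. \<forall>Y\<in>tangent_space M p.
        metric N (\<phi> p) (second_fund M N \<phi> p X Y) (tension M N \<phi> p) =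
          1 / real CARD('m) * (tension_norm M N \<phi> p)\<^sup>2 * metric M p X Y)"

end

(* With B the second fundamental form and \<tau> its trace, \<tau> is normal to the immersion.
   Differentiating <\<tau>, d\<phi>(X)> = 0 gives <d\<phi>(X), \<nabla>_Y \<tau>> = - <B(X,Y), \<tau>>, hence
   S_2 = 2 <B, \<tau>> - 1/2 |\<tau>|^2 g. The equivalence follows by taking the trace of S_2 = \<lambda> g, which reads
   (4 - m) |\<tau>|^2 = 2 m \<lambda>. The one computation behind both
   the normality of B and the transformation law of the Christoffel symbols is that for an
   isometric map f between open sets the expression D^2 f + \<Gamma>'(Df, Df) - Df \<Gamma> is orthogonal to the
   image of Df; for transition maps Df is onto, so the expression vanishes. *)
theory Submission
  imports Defs
begin

section \<open>Calculus of smooth maps between open sets\<close>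

text \<open>The definitions rest on arbitrary choices: \<open>frechet_derivative\<close> has an
  unspecified value where no derivative exists, \<open>dir_deriv\<close> and
  \<open>second_fund\<close> read everything in \<open>chart_at\<close>, which may jump from point
  to point, and \<open>onb\<close> picks a basis at each point separately. The tension field is a
  sum over \<open>onb\<close>, so not even its differentiability is visible, yet S_2 contains its
  covariant derivative. For this reason the geometry is carried out on coordinate expressions over
  open sets, with the trace written through the inverse Gram matrix, whose entries are
  differentiable by Cramer's rule. The manifold notions are compared with these expressions in an
  arbitrary fixed pair of charts, which can be kept along a whole neighbourhood. A second obligation
  comes from the metric: its axioms constrain it only on \<open>tangent_space\<close>, so each
  family of coordinate vectors fed into it, in particular the covariant derivative of the tension
  field, must be shown to transform correctly.\<close>

abbreviation D where "D f x \<equiv> frechet_derivative f (at x)"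

lemma smooth_on_differentiable: "smooth_on S f \<Longrightarrow> x \<in> S \<Longrightarrow> f differentiable (at x)"
  unfolding smooth_on_def using Ck_on.simps(2)[of 0 S f] by blast

lemma smooth_on_has_derivative: "smooth_on S f \<Longrightarrow> x \<in> S \<Longrightarrow> (f has_derivative D f x) (at x)"
  using smooth_on_differentiable frechet_derivative_works by blast

lemma smooth_on_D: "smooth_on S f \<Longrightarrow> smooth_on S (\<lambda>x. D f x v)"
  unfolding smooth_on_def using Ck_on.simps(2)[of _ S f] by blast

lemma smooth_on_continuous: "smooth_on S f \<Longrightarrow> continuous_on S f"
  unfolding smooth_on_def using Ck_on.simps(1)[of S f] by blast

lemma Ck_on_subset: "Ck_on k S f \<Longrightarrow> T \<subseteq> S \<Longrightarrow> Ck_on k T f"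
  by (induction k arbitrary: f) (auto intro: continuous_on_subset)

lemma smooth_on_subset: "smooth_on S f \<Longrightarrow> T \<subseteq> S \<Longrightarrow> smooth_on T f"
  unfolding smooth_on_def using Ck_on_subset by blast

lemma D_eq: "(f has_derivative f') (at x) \<Longrightarrow> D f x = f'"
  using frechet_derivative_at by metis

text \<open>Both functions have the same set of derivatives at \<open>x\<close>, and
  \<open>frechet_derivative\<close> is a choice from that set; so the values agree even where no
  derivative exists.\<close>

lemma D_cong_on:
  assumes "open S" "x \<in> S" "\<And>y. y \<in> S \<Longrightarrow> f y = h y"
  shows "D f x = D h x"
proof -
  have "(f has_derivative f') (at x) \<longleftrightarrow> (h has_derivative f') (at x)" for f'
    using assms has_derivative_transform_within_open[of f f' x UNIV S h]
      has_derivative_transform_within_open[of h f' x UNIV S f] by auto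
  thus ?thesis unfolding frechet_derivative_def by simp
qed

lemma linear_basis_expansion:
  fixes l :: "'a::euclidean_space \<Rightarrow> 'b::real_vector"
  assumes "linear l"
  shows "l v = (\<Sum>b\<in>Basis. (v \<bullet> b) *\<^sub>R l b)"
proof -
  have "l v = l (\<Sum>b\<in>Basis. (v \<bullet> b) *\<^sub>R b)" by (simp add: euclidean_representation)
  also have "\<dots> = (\<Sum>b\<in>Basis. (v \<bullet> b) *\<^sub>R l b)"
    using assms by (simp add: linear_sum linear_scale)
  finally show ?thesis .
qed

lemma linear_D_param:
  fixes L :: "'e::real_normed_vector \<Rightarrow> 'k::real_vector \<Rightarrow> 'f::real_normed_vector"
  assumes "open S" "y \<in> S" "\<And>z. z \<in> S \<Longrightarrow> linear (L z)" "\<And>v. (\<lambda>z. L z v) differentiable (at y)"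
  shows "linear (\<lambda>v. D (\<lambda>z. L z v) y u)"
proof (rule linearI)
  note d = assms(4)[unfolded frechet_derivative_works]
  fix v w :: 'k and r :: real
  have "D (\<lambda>z. L z (v + w)) y = D (\<lambda>z. L z v + L z w) y"
    by (rule D_cong_on[OF assms(1,2)]) (simp add: assms(3) linear_add)
  also have "\<dots> = (\<lambda>u. D (\<lambda>z. L z v) y u + D (\<lambda>z. L z w) y u)"
    by (rule D_eq) (intro derivative_intros d)
  finally show "D (\<lambda>z. L z (v + w)) y u = D (\<lambda>z. L z v) y u + D (\<lambda>z. L z w) y u" by simp
  have "D (\<lambda>z. L z (r *\<^sub>R v)) y = D (\<lambda>z. r *\<^sub>R L z v) y"
    by (rule D_cong_on[OF assms(1,2)]) (simp add: assms(3) linear_scale)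
  also have "\<dots> = (\<lambda>u. r *\<^sub>R D (\<lambda>z. L z v) y u)"
    by (rule D_eq) (intro derivative_intros d)
  finally show "D (\<lambda>z. L z (r *\<^sub>R v)) y u = r *\<^sub>R D (\<lambda>z. L z v) y u" by simp
qed

text \<open>Product rule for a family of linear maps. Expanding \<open>V z\<close> in the finite
  basis turns the expression into a sum of scalars times vectors, so differentiability of
  \<open>L\<close> for each fixed argument suffices and no norm on linear maps enters.\<close>

lemma has_derivative_param_linear:
  fixes L :: "'e::real_normed_vector \<Rightarrow> 'k::euclidean_space \<Rightarrow> 'f::real_normed_vector"
  assumes S: "open S" "g x \<in> S" and lin: "\<And>y. y \<in> S \<Longrightarrow> linear (L y)"
    and diff: "\<And>v. (\<lambda>y. L y v) differentiable (at (g x))"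
    and g: "(g has_derivative g') (at x)" and V: "(V has_derivative V') (at x)"
  shows "((\<lambda>z. L (g z) (V z)) has_derivative
           (\<lambda>h. D (\<lambda>y. L y (V x)) (g x) (g' h) + L (g x) (V' h))) (at x)"
proof -
  have "\<forall>\<^sub>F z in at x. g z \<in> S"
    using has_derivative_continuous[OF g] S by (simp add: continuous_within tendsto_def)
  then have ev: "\<forall>\<^sub>F z in at x. (\<Sum>b\<in>Basis. (V z \<bullet> b) *\<^sub>R L (g z) b) = L (g z) (V z)"
    by eventually_elim (simp add: linear_basis_expansion[OF lin, symmetric])
  have 1: "((\<lambda>z. \<Sum>b\<in>Basis. (V z \<bullet> b) *\<^sub>R L (g z) b) has_derivative
     (\<lambda>h. \<Sum>b\<in>Basis. (V x \<bullet> b) *\<^sub>R D (\<lambda>y. L y b) (g x) (g' h) + (V' h \<bullet> b) *\<^sub>R L (g x) b)) (at x)"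
    by (intro derivative_intros V has_derivative_compose[OF g]
        diff[unfolded frechet_derivative_works])
  have "((\<lambda>z. L (g z) (V z)) has_derivative
     (\<lambda>h. \<Sum>b\<in>Basis. (V x \<bullet> b) *\<^sub>R D (\<lambda>y. L y b) (g x) (g' h) + (V' h \<bullet> b) *\<^sub>R L (g x) b)) (at x)"
    by (rule has_derivative_transform_eventually[OF 1 ev])
      (auto simp: linear_basis_expansion[OF lin[OF S(2)], symmetric])
  thus ?thesis
    by (simp add: sum.distrib linear_basis_expansion[OF lin[OF S(2)], symmetric]
        linear_basis_expansion[OF linear_D_param[OF S lin diff], symmetric])
qed

lemma has_derivative_param_bilinear:
  fixes G :: "'e::real_normed_vector \<Rightarrow> 'k::euclidean_space \<Rightarrow> 'l::euclidean_space \<Rightarrow> 'f::real_normed_vector"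
  assumes S: "open S" "f x \<in> S" and bil: "\<And>y. y \<in> S \<Longrightarrow> bilinear (G y)"
    and diff: "\<And>v w. (\<lambda>y. G y v w) differentiable (at (f x))"
    and f: "(f has_derivative f') (at x)" and V: "(V has_derivative V') (at x)"
    and W: "(W has_derivative W') (at x)"
  shows "((\<lambda>z. G (f z) (V z) (W z)) has_derivative
           (\<lambda>h. D (\<lambda>y. G y (V x) (W x)) (f x) (f' h) + G (f x) (V' h) (W x) + G (f x) (V x) (W' h))) (at x)"
proof -
  have lin1: "linear (\<lambda>v. G y v w)" and lin2: "linear (G y v)" if "y \<in> S" for y v w
    using bil[OF that] unfolding bilinear_def by auto
  \<comment> \<open>The pair of point and first argument becomes a single parameter, which leaves a
    family that is linear in the second argument.\<close>
  define L where "L = (\<lambda>p. G (fst p) (snd p))"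
  have 1: "((\<lambda>p. L p w) has_derivative
      (\<lambda>h. D (\<lambda>y. G y (V x) w) (f x) (fst h) + G (f x) (snd h) w)) (at (f x, V x))" for w
  proof -
    have "(fst has_derivative fst) (at (f x, V x))" "(snd has_derivative snd) (at (f x, V x))"
      by (auto intro!: bounded_linear_imp_has_derivative bounded_linear_fst bounded_linear_snd)
    from has_derivative_param_linear[of S fst "(f x, V x)" "\<lambda>y v. G y v w", OF S(1) _ lin1 _ this]
    show ?thesis using S(2) diff by (simp add: L_def)
  qed
  have "((\<lambda>z. L (f z, V z) (W z)) has_derivative
      (\<lambda>h. D (\<lambda>p. L p (W x)) (f x, V x) (f' h, V' h) + L (f x, V x) (W' h))) (at x)"
    by (rule has_derivative_param_linear[of "S \<times> UNIV"])
      (use S f V W 1 lin2 in \<open>auto simp: L_def differentiable_def open_Times intro!: derivative_intros\<close>)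
  thus ?thesis
    by (simp add: D_eq[OF 1]) (simp add: L_def)
qed

section \<open>Symmetry of second derivatives\<close>

text \<open>The mean value theorem is used twice: along \<open>a\<close> for the difference of
  \<open>f\<close> between the two parallel edges, and along \<open>b\<close> for the resulting
  difference of first derivatives.\<close>

lemma second_difference_MVT:
  fixes f :: "'e::euclidean_space \<Rightarrow> real"
  assumes sm: "smooth_on S f" and t: "t > 0"
    and sub: "\<forall>s\<in>{0..t}. \<forall>u\<in>{0..t}. x + s *\<^sub>R a + u *\<^sub>R b \<in> S"
  shows "\<exists>s u. 0 \<le> s \<and> s \<le> t \<and> 0 \<le> u \<and> u \<le> t \<and>
    f (x + t *\<^sub>R a + t *\<^sub>R b) - f (x + t *\<^sub>R a) - f (x + t *\<^sub>R b) + f x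
      = t * t * D (\<lambda>y. D f y a) (x + s *\<^sub>R a + u *\<^sub>R b) b"
proof -
  have d1: "((\<lambda>s. f (x + s *\<^sub>R a + u *\<^sub>R b)) has_real_derivative D f (x + s *\<^sub>R a + u *\<^sub>R b) a) (at s)"
    if "0 \<le> s" "s \<le> t" "0 \<le> u" "u \<le> t" for s u
  proof -
    from sub that have "x + s *\<^sub>R a + u *\<^sub>R b \<in> S" by simp
    note hd = smooth_on_has_derivative[OF sm this]
    have "((\<lambda>s. f (x + s *\<^sub>R a + u *\<^sub>R b)) has_derivative (\<lambda>h. D f (x + s *\<^sub>R a + u *\<^sub>R b) (h *\<^sub>R a))) (at s)"
      by (rule has_derivative_compose[of "\<lambda>s. x + s *\<^sub>R a + u *\<^sub>R b", OF _ hd]) (auto intro!: derivative_eq_intros)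
    thus ?thesis
      using linear_scale[OF has_derivative_linear[OF hd]]
      unfolding has_field_derivative_def
      by (elim has_derivative_eq_rhs) (simp add: fun_eq_iff mult.commute)
  qed
  have d2: "((\<lambda>u. D f (x + s *\<^sub>R a + u *\<^sub>R b) a) has_real_derivative D (\<lambda>y. D f y a) (x + s *\<^sub>R a + u *\<^sub>R b) b) (at u)"
    if "0 \<le> s" "s \<le> t" "0 \<le> u" "u \<le> t" for s u
  proof -
    from sub that have "x + s *\<^sub>R a + u *\<^sub>R b \<in> S" by simp
    note hd = smooth_on_has_derivative[OF smooth_on_D[OF sm] this]
    have "((\<lambda>u. D f (x + s *\<^sub>R a + u *\<^sub>R b) a) has_derivative (\<lambda>h. D (\<lambda>y. D f y a) (x + s *\<^sub>R a + u *\<^sub>R b) (h *\<^sub>R b))) (at u)"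
      by (rule has_derivative_compose[of "\<lambda>u. x + s *\<^sub>R a + u *\<^sub>R b", OF _ hd]) (auto intro!: derivative_eq_intros)
    thus ?thesis
      using linear_scale[OF has_derivative_linear[OF hd]]
      unfolding has_field_derivative_def
      by (elim has_derivative_eq_rhs) (simp add: fun_eq_iff mult.commute)
  qed
  have "\<exists>s. 0 < s \<and> s < t \<and> (f (x + t *\<^sub>R a + t *\<^sub>R b) - f (x + t *\<^sub>R a + 0 *\<^sub>R b)) - (f (x + 0 *\<^sub>R a + t *\<^sub>R b) - f (x + 0 *\<^sub>R a + 0 *\<^sub>R b))
      = (t - 0) * (D f (x + s *\<^sub>R a + t *\<^sub>R b) a - D f (x + s *\<^sub>R a + 0 *\<^sub>R b) a)"
    by (rule MVT2[OF t, of "\<lambda>s. f (x + s *\<^sub>R a + t *\<^sub>R b) - f (x + s *\<^sub>R a + 0 *\<^sub>R b)"])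
      (intro DERIV_diff d1, use t in auto)
  then obtain s where s: "0 < s" "s < t" and e1: "(f (x + t *\<^sub>R a + t *\<^sub>R b) - f (x + t *\<^sub>R a)) - (f (x + t *\<^sub>R b) - f x)
      = t * (D f (x + s *\<^sub>R a + t *\<^sub>R b) a - D f (x + s *\<^sub>R a) a)" by auto
  have "\<exists>u. 0 < u \<and> u < t \<and> D f (x + s *\<^sub>R a + t *\<^sub>R b) a - D f (x + s *\<^sub>R a + 0 *\<^sub>R b) a
     = (t - 0) * D (\<lambda>y. D f y a) (x + s *\<^sub>R a + u *\<^sub>R b) b"
    by (rule MVT2[OF t, of "\<lambda>u. D f (x + s *\<^sub>R a + u *\<^sub>R b) a"]) (use d2 s in auto)
  then obtain u where "0 < u" "u < t" "D f (x + s *\<^sub>R a + t *\<^sub>R b) a - D f (x + s *\<^sub>R a) a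
     = t * D (\<lambda>y. D f y a) (x + s *\<^sub>R a + u *\<^sub>R b) b" by auto
  with s e1 show ?thesis by (intro exI[of _ s] exI[of _ u]) auto
qed

text \<open>The second difference over a parallelogram is symmetric in \<open>a\<close> and
  \<open>b\<close>. It equals \<open>t * t\<close> times either mixed derivative at some point of
  the parallelogram, so by continuity the two derivatives cannot differ at \<open>x\<close>.\<close>

lemma schwarz_real:
  fixes f :: "'e::euclidean_space \<Rightarrow> real"
  assumes sm: "smooth_on S f" and S: "open S" "x \<in> S"
  shows "D (\<lambda>y. D f y a) x b = D (\<lambda>y. D f y b) x a"
proof (rule ccontr)
  let ?H1 = "\<lambda>y. D (\<lambda>y. D f y a) y b" and ?H2 = "\<lambda>y. D (\<lambda>y. D f y b) y a"
  assume ne: "?H1 x \<noteq> ?H2 x"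
  have c: "isCont ?H1 x" "isCont ?H2 x"
    using smooth_on_continuous[OF smooth_on_D[OF smooth_on_D[OF sm]]] S
    by (auto simp: continuous_on_eq_continuous_at)
  \<comment> \<open>Half the gap: two deviations below \<open>e\<close> are together smaller than
    the gap.\<close>
  define e where "e = \<bar>?H1 x - ?H2 x\<bar> / 2"
  have e: "e > 0" using ne by (simp add: e_def)
  obtain d1 where d1: "d1 > 0" "\<And>y. dist y x < d1 \<Longrightarrow> dist (?H1 y) (?H1 x) < e"
    using c(1) e unfolding continuous_at_eps_delta by meson
  obtain d2 where d2: "d2 > 0" "\<And>y. dist y x < d2 \<Longrightarrow> dist (?H2 y) (?H2 x) < e"
    using c(2) e unfolding continuous_at_eps_delta by meson
  obtain d3 where d3: "d3 > 0" "\<And>y. dist y x < d3 \<Longrightarrow> y \<in> S"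
    using S unfolding open_dist by meson
  define d where "d = min d1 (min d2 d3)"
  \<comment> \<open>Small enough to keep the whole parallelogram within \<open>d / 2\<close> of
    \<open>x\<close>; the \<open>1\<close> keeps the denominator positive when \<open>a\<close> and
    \<open>b\<close> vanish.\<close>
  define t where "t = d / (2 * (norm a + norm b + 1))"
  have d: "d > 0" using d1 d2 d3 by (simp add: d_def)
  have n: "norm a + norm b + 1 > 0" by (smt (verit) norm_ge_zero)
  have t: "t > 0" using d n by (simp add: t_def)
  have near: "dist (x + s *\<^sub>R a + u *\<^sub>R b) x < d" if "0 \<le> s" "s \<le> t" "0 \<le> u" "u \<le> t" for s u
  proof -
    have "dist (x + s *\<^sub>R a + u *\<^sub>R b) x = norm (s *\<^sub>R a + u *\<^sub>R b)" by (simp add: dist_norm algebra_simps)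
    also have "\<dots> \<le> s * norm a + u * norm b" using norm_triangle_ineq[of "s *\<^sub>R a" "u *\<^sub>R b"] that by simp
    also have "\<dots> \<le> t * norm a + t * norm b" using that by (intro add_mono mult_right_mono) auto
    also have "\<dots> \<le> t * (norm a + norm b + 1)" using t by (simp add: algebra_simps)
    also have "\<dots> = d / 2" unfolding t_def using n by (auto simp: divide_simps)
    also have "\<dots> < d" using d by simp
    finally show ?thesis .
  qed
  have sub: "\<forall>s\<in>{0..t}. \<forall>u\<in>{0..t}. x + s *\<^sub>R a + u *\<^sub>R b \<in> S"
    using near d3(2) by (simp add: d_def)
  have sub': "\<forall>s\<in>{0..t}. \<forall>u\<in>{0..t}. x + s *\<^sub>R b + u *\<^sub>R a \<in> S"
  proof (intro ballI)
    fix s u assume "s \<in> {0..t}" "u \<in> {0..t}"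
    with sub have "x + u *\<^sub>R a + s *\<^sub>R b \<in> S" by blast
    thus "x + s *\<^sub>R b + u *\<^sub>R a \<in> S" by (simp add: add_ac)
  qed
  obtain s u where su: "0 \<le> s" "s \<le> t" "0 \<le> u" "u \<le> t" and
    q1: "f (x + t *\<^sub>R a + t *\<^sub>R b) - f (x + t *\<^sub>R a) - f (x + t *\<^sub>R b) + f x = t * t * ?H1 (x + s *\<^sub>R a + u *\<^sub>R b)"
    using second_difference_MVT[OF sm t sub] by (elim exE conjE) (rule that)
  obtain s' u' where su': "0 \<le> s'" "s' \<le> t" "0 \<le> u'" "u' \<le> t" and
    q2: "f (x + t *\<^sub>R b + t *\<^sub>R a) - f (x + t *\<^sub>R b) - f (x + t *\<^sub>R a) + f x = t * t * ?H2 (x + s' *\<^sub>R b + u' *\<^sub>R a)"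
    using second_difference_MVT[OF sm t sub'] by (elim exE conjE) (rule that)
  have "t * t * ?H1 (x + s *\<^sub>R a + u *\<^sub>R b) = t * t * ?H2 (x + s' *\<^sub>R b + u' *\<^sub>R a)"
    unfolding q1[symmetric] q2[symmetric] by (simp add: add_ac)
  hence eq: "?H1 (x + s *\<^sub>R a + u *\<^sub>R b) = ?H2 (x + u' *\<^sub>R a + s' *\<^sub>R b)"
    using t by (simp add: add_ac)
  have "dist (?H1 (x + s *\<^sub>R a + u *\<^sub>R b)) (?H1 x) < e"
    using near[OF su] by (intro d1) (simp add: d_def)
  moreover have "dist (?H2 (x + u' *\<^sub>R a + s' *\<^sub>R b)) (?H2 x) < e"
    using near[OF su'(3,4,1,2)] by (intro d2) (simp add: d_def)
  ultimately have "\<bar>?H1 x - ?H2 x\<bar> < 2 * e" unfolding eq dist_real_def by linarith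
  thus False by (simp add: e_def)
qed

lemma D_inner_right:
  assumes "f differentiable (at x)"
  shows "D (\<lambda>y. f y \<bullet> c) x v = D f x v \<bullet> c"
  using D_eq[OF has_derivative_inner_left[OF assms[unfolded frechet_derivative_works], of c]] by simp

lemma Ck_on_cong:
  assumes "open S" "\<And>x. x \<in> S \<Longrightarrow> f x = h x" "Ck_on k S f"
  shows "Ck_on k S h"
  using assms(2,3)
proof (induction k arbitrary: f h)
  case 0
  then show ?case by (simp cong: continuous_on_cong)
next
  case (Suc k)
  have "h differentiable (at x)" if "x \<in> S" for x
    using Suc.prems assms(1) that has_derivative_transform_within_open[of f _ x UNIV S h]
    unfolding differentiable_def by (metis Ck_on.simps(2) differentiable_def)
  moreover have "Ck_on k S (\<lambda>x. D h x v)" for v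
    using Suc.IH[of "\<lambda>x. D f x v" "\<lambda>x. D h x v"] Suc.prems D_cong_on[OF assms(1), of _ f h] by auto
  ultimately show ?case by simp
qed

lemma smooth_on_inner:
  assumes "open S" "smooth_on S f"
  shows "smooth_on S (\<lambda>x. f x \<bullet> c)"
proof -
  have "Ck_on k S f \<Longrightarrow> Ck_on k S (\<lambda>x. f x \<bullet> c)" for k
  proof (induction k arbitrary: f)
    case 0
    then show ?case by (auto intro: continuous_intros)
  next
    case (Suc k)
    have "Ck_on k S (\<lambda>x. D f x v \<bullet> c)" for v using Suc by simp
    then have "Ck_on k S (\<lambda>x. D (\<lambda>y. f y \<bullet> c) x v)" for v
      by (rule Ck_on_cong[OF assms(1), rotated]) (use Suc.prems in \<open>simp add: D_inner_right\<close>)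
    with Suc.prems show ?case by (auto intro!: differentiable_inner)
  qed
  with assms show ?thesis unfolding smooth_on_def by blast
qed

text \<open>Reduced to the real case by taking inner products with basis vectors, which commute with
  derivatives.\<close>

lemma schwarz:
  fixes f :: "'e::euclidean_space \<Rightarrow> 'f::euclidean_space"
  assumes sm: "smooth_on S f" and S: "open S" "x \<in> S"
  shows "D (\<lambda>y. D f y a) x b = D (\<lambda>y. D f y b) x a"
proof (rule euclidean_eqI)
  fix c :: 'f
  have "D (\<lambda>y. D f y v) x w \<bullet> c = D (\<lambda>y. D (\<lambda>y. f y \<bullet> c) y v) x w" for v w
  proof -
    have "D (\<lambda>y. D (\<lambda>y. f y \<bullet> c) y v) x = D (\<lambda>y. D f y v \<bullet> c) x"
      by (rule D_cong_on[OF S]) (simp add: D_inner_right smooth_on_differentiable[OF sm])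
    thus ?thesis
      by (simp add: D_inner_right smooth_on_differentiable[OF smooth_on_D[OF sm] S(2)])
  qed
  with schwarz_real[OF smooth_on_inner[OF S(1) sm] S]
  show "D (\<lambda>y. D f y a) x b \<bullet> c = D (\<lambda>y. D f y b) x a \<bullet> c" by simp
qed

section \<open>Regularity of solutions of linear systems\<close>

lemma differentiable_prod:
  fixes f :: "'i \<Rightarrow> 'e::real_normed_vector \<Rightarrow> 'f::real_normed_field"
  assumes "\<And>i. i \<in> I \<Longrightarrow> f i differentiable (at x)"
  shows "(\<lambda>y. \<Prod>i\<in>I. f i y) differentiable (at x)"
  using assms by (induction I rule: infinite_finite_induct) auto

lemma differentiable_det:
  fixes A :: "'e::real_normed_vector \<Rightarrow> real^'n^'n"
  assumes "\<And>i j. (\<lambda>y. A y $ i $ j) differentiable (at x)"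
  shows "(\<lambda>y. det (A y)) differentiable (at x)"
  unfolding det_def
  by (intro differentiable_sum differentiable_mult differentiable_const ballI differentiable_prod assms finite_permutations)
    auto

lemma differentiable_vec:
  fixes f :: "'e::real_normed_vector \<Rightarrow> real^'n"
  assumes "\<And>i. (\<lambda>y. f y $ i) differentiable (at x)"
  shows "f differentiable (at x)"
  using assms unfolding differentiable_componentwise_within[of f x UNIV]
  by (auto simp: Basis_vec_def inner_axis)

lemma differentiable_transform_open:
  assumes "f differentiable (at x)" "open S" "x \<in> S" "\<And>y. y \<in> S \<Longrightarrow> f y = h y"
  shows "h differentiable (at x)"
  using assms has_derivative_transform_within_open[of f _ x UNIV S h]
  unfolding differentiable_def by blast

text \<open>Cramer's rule writes each component of \<open>z\<close> as a quotient of determinants.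
  The Christoffel symbols and the inverse Gram matrix, known only through the equations they solve,
  get their differentiability from here.\<close>

lemma differentiable_linear_solve:
  fixes A :: "'e::real_normed_vector \<Rightarrow> real^'n^'n"
  assumes A: "\<And>i j. (\<lambda>y. A y $ i $ j) differentiable (at x)"
    and r: "\<And>i. (\<lambda>y. r y $ i) differentiable (at x)"
    and S: "open S" "x \<in> S"
    and sol: "\<And>y. y \<in> S \<Longrightarrow> det (A y) \<noteq> 0" "\<And>y. y \<in> S \<Longrightarrow> A y *v z y = r y"
  shows "z differentiable (at x)"
proof (rule differentiable_vec)
  fix k
  let ?q = "\<lambda>y. det (\<chi> i j. if j = k then r y $ i else A y $ i $ j) / det (A y)"
  have "?q differentiable (at x)"
  proof (intro differentiable_divide differentiable_det A sol S)
    show "(\<lambda>y. (\<chi> i j. if j = k then r y $ i else A y $ i $ j) $ i $ j) differentiable (at x)" for i j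
      using A r by (cases "j = k") auto
  qed
  then show "(\<lambda>y. z y $ k) differentiable (at x)"
    by (rule differentiable_transform_open[OF _ S]) (use sol in \<open>simp add: cramer\<close>)
qed

section \<open>Metrics and isometric maps in coordinates\<close>

definition metric_field :: "(real^'m::finite) set \<Rightarrow> (real^'m \<Rightarrow> real^'m \<Rightarrow> real^'m \<Rightarrow> real) \<Rightarrow> bool" where
  "metric_field S g \<longleftrightarrow> open S \<and>
     (\<forall>x\<in>S. bilinear (g x) \<and> (\<forall>a b. g x a b = g x b a) \<and> (\<forall>a. a \<noteq> 0 \<longrightarrow> g x a a > 0)) \<and>
     (\<forall>a b. smooth_on S (\<lambda>x. g x a b))"

definition koszul :: "(real^'m::finite \<Rightarrow> real^'m \<Rightarrow> real^'m \<Rightarrow> real) \<Rightarrow> real^'m \<Rightarrow> real^'m \<Rightarrow> real^'m \<Rightarrow> real^'m \<Rightarrow> real" where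
  "koszul g x a b w = D (\<lambda>y. g y b w) x a + D (\<lambda>y. g y a w) x b - D (\<lambda>y. g y a b) x w"

text \<open>The body of \<open>christoffel\<close> with the point replaced by its coordinates, so
  that the two agree by unfolding.\<close>

definition chris :: "(real^'m::finite \<Rightarrow> real^'m \<Rightarrow> real^'m \<Rightarrow> real) \<Rightarrow> real^'m \<Rightarrow> real^'m \<Rightarrow> real^'m \<Rightarrow> real^'m" where
  "chris g x a b = (THE z. \<forall>w. 2 * g x z w = koszul g x a b w)"

text \<open>The pull-back connection along \<open>f\<close> in coordinates, for a field
  \<open>V\<close> along \<open>f\<close> in the direction \<open>a\<close>.\<close>

definition cov :: "(real^'n::finite \<Rightarrow> real^'n \<Rightarrow> real^'n \<Rightarrow> real) \<Rightarrow> (real^'m::finite \<Rightarrow> real^'n) \<Rightarrow> (real^'m \<Rightarrow> real^'n)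
    \<Rightarrow> real^'m \<Rightarrow> real^'m \<Rightarrow> real^'n" where
  "cov G f V x a = D V x a + chris G (f x) (D f x a) (V x)"

definition sff :: "(real^'m::finite \<Rightarrow> real^'m \<Rightarrow> real^'m \<Rightarrow> real) \<Rightarrow> (real^'n::finite \<Rightarrow> real^'n \<Rightarrow> real^'n \<Rightarrow> real)
    \<Rightarrow> (real^'m \<Rightarrow> real^'n) \<Rightarrow> real^'m \<Rightarrow> real^'m \<Rightarrow> real^'m \<Rightarrow> real^'n" where
  "sff g G f x a b = cov G f (\<lambda>y. D f y b) x a - D f x (chris g x a b)"

definition gram :: "(real^'m::finite \<Rightarrow> real^'m \<Rightarrow> real^'m \<Rightarrow> real) \<Rightarrow> real^'m \<Rightarrow> real^'m^'m" where
  "gram g x = (\<chi> i j. g x (axis i 1) (axis j 1))"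

text \<open>The trace is taken with the inverse Gram matrix and not with an orthonormal basis,
  because its entries vary differentiably with the point, while the bases given by
  \<open>onb\<close> need not.\<close>

definition trace_sff :: "(real^'m::finite \<Rightarrow> real^'m \<Rightarrow> real^'m \<Rightarrow> real) \<Rightarrow> (real^'n::finite \<Rightarrow> real^'n \<Rightarrow> real^'n \<Rightarrow> real)
    \<Rightarrow> (real^'m \<Rightarrow> real^'n) \<Rightarrow> real^'m \<Rightarrow> real^'n" where
  "trace_sff g G f x = (\<Sum>i\<in>UNIV. \<Sum>j\<in>UNIV. matrix_inv (gram g x) $ i $ j *\<^sub>R sff g G f x (axis i 1) (axis j 1))"

lemma axis_expansion: "(v::real^'m::finite) = (\<Sum>i\<in>UNIV. v $ i *\<^sub>R axis i 1)"
  using basis_expansion[of v] by (simp add: scalar_mult_eq_scaleR)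

lemma linear_axis_expansion:
  fixes l :: "real^'m::finite \<Rightarrow> 'b::real_vector"
  assumes "linear l"
  shows "l v = (\<Sum>i\<in>UNIV. v $ i *\<^sub>R l (axis i 1))"
  by (subst axis_expansion) (simp add: linear_sum[OF assms] linear_scale[OF assms])

lemma linear_add_diff:
  "linear f \<Longrightarrow> linear h \<Longrightarrow> linear (\<lambda>x. f x + h x)"
  "linear f \<Longrightarrow> linear h \<Longrightarrow> linear (\<lambda>x. f x - h x)"
  by (auto intro!: linearI simp: linear_add linear_scale algebra_simps)

text \<open>Riesz representation for a positive definite form. Positivity makes
  \<open>z \<mapsto> \<beta>(z, _)\<close> injective, and equality of dimensions makes it
  onto.\<close>

lemma form_representation:
  fixes \<beta> :: "real^'m::finite \<Rightarrow> real^'m \<Rightarrow> real"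
  assumes bil: "bilinear \<beta>" and pos: "\<And>a. a \<noteq> 0 \<Longrightarrow> \<beta> a a > 0" and l: "linear l"
  shows "\<exists>!z. \<forall>w. \<beta> z w = l w"
proof -
  have lin: "linear (\<lambda>v. \<beta> v w)" "linear (\<beta> v)" for v w
    using bil unfolding bilinear_def by auto
  define F where "F z = (\<chi> i. \<beta> z (axis i 1))" for z
  have F_eq: "\<beta> z w = (\<Sum>i\<in>UNIV. w $ i * F z $ i)" for z w
    using linear_axis_expansion[OF lin(2)[of z], of w] by (simp add: F_def)
  have linF: "linear F"
    by (rule linearI) (auto simp: F_def vec_eq_iff linear_add[OF lin(1)] linear_scale[OF lin(1)])
  have inj: "inj F"
    unfolding linear_injective_0[OF linF]
  proof (intro allI impI)
    fix z assume "F z = 0"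
    hence "\<beta> z z = 0" by (simp add: F_eq)
    thus "z = 0" using pos[of z] by fastforce
  qed
  then obtain z where z: "F z = (\<chi> i. l (axis i 1))"
    using linear_injective_imp_surjective[OF linF] by (metis surjD)
  have "\<beta> z w = l w" for w
    unfolding F_eq z by (subst linear_axis_expansion[OF l]) simp
  moreover have "z' = z" if "\<And>w. \<beta> z' w = l w" for z'
  proof -
    have "F z' = F z" unfolding z by (simp add: F_def that)
    with inj show ?thesis by (simp add: inj_eq)
  qed
  ultimately show ?thesis by blast
qed

text \<open>Gram-Schmidt, by induction over the set of indices already treated.\<close>

lemma exists_orthonormal:
  fixes \<beta> :: "real^'m::finite \<Rightarrow> real^'m \<Rightarrow> real"
  assumes bil: "bilinear \<beta>" and sym: "\<And>a b. \<beta> a b = \<beta> b a" and pos: "\<And>a. a \<noteq> 0 \<Longrightarrow> \<beta> a a > 0"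
  shows "\<exists>e. \<forall>i j. \<beta> (e i) (e j) = (if i = (j::'m) then 1 else 0)"
proof -
  have "\<exists>e. \<forall>i\<in>I. \<forall>j\<in>I. \<beta> (e i) (e j) = (if i = j then 1 else 0)" for I :: "'m set"
    using finite[of I]
  proof (induction I rule: finite_induct)
    case empty
    then show ?case by simp
  next
    case (insert k I)
    then obtain e where e: "\<And>i j. i \<in> I \<Longrightarrow> j \<in> I \<Longrightarrow> \<beta> (e i) (e j) = (if i = j then 1 else 0)" by blast
    \<comment> \<open>Fewer than \<open>CARD('m)\<close> vectors cannot span the space, so there is
      a vector left to orthogonalize.\<close>
    have "dim (span (e ` I)) \<le> card (e ` I)" by (simp add: dim_le_card')
    also have "\<dots> \<le> card I" by (rule card_image_le) simp
    also have "\<dots> < card (insert k I)" using insert by simp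
    also have "\<dots> \<le> CARD('m)" by (rule card_mono) auto
    finally have lt: "dim (span (e ` I)) < CARD('m)" .
    have "span (e ` I) \<noteq> UNIV"
    proof
      assume "span (e ` I) = UNIV"
      with lt show False by (simp del: dim_span)
    qed
    then obtain v where v: "v \<notin> span (e ` I)" by blast
    define u where "u = v - (\<Sum>i\<in>I. \<beta> v (e i) *\<^sub>R e i)"
    have "(\<Sum>i\<in>I. \<beta> v (e i) *\<^sub>R e i) \<in> span (e ` I)"
      by (intro span_sum span_scale span_base) auto
    hence u0: "u \<noteq> 0" using v by (auto simp: u_def)
    interpret l: linear "\<lambda>x. \<beta> x w" for w using bil by (simp add: bilinear_def)
    have orth: "\<beta> u (e j) = 0" if "j \<in> I" for j
    proof -
      have "\<beta> u (e j) = \<beta> v (e j) - (\<Sum>i\<in>I. \<beta> v (e i) * \<beta> (e i) (e j))"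
        by (simp add: u_def l.diff l.sum l.scale)
      also have "(\<Sum>i\<in>I. \<beta> v (e i) * \<beta> (e i) (e j)) = (\<Sum>i\<in>I. if i = j then \<beta> v (e i) else 0)"
        by (rule sum.cong) (use e that in auto)
      finally show ?thesis using that by simp
    qed
    define r where "r = 1 / sqrt (\<beta> u u)"
    have r: "r * r * \<beta> u u = 1" using pos[OF u0] by (simp add: r_def)
    define e' where "e' = e(k := r *\<^sub>R u)"
    have "\<beta> (e' i) (e' j) = (if i = j then 1 else 0)" if "i \<in> insert k I" "j \<in> insert k I" for i j
      using that insert(2) e r orth sym[of "e i" u]
      by (auto simp: e'_def bilinear_lmul[OF bil] bilinear_rmul[OF bil])
    then show ?case by blast
  qed
  from this[of UNIV] show ?thesis by auto
qed

section \<open>Christoffel symbols and traces for a metric in coordinates\<close>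

context
  fixes S :: "(real^'m::finite) set" and g :: "real^'m \<Rightarrow> real^'m \<Rightarrow> real^'m \<Rightarrow> real"
  assumes mf: "metric_field S g"
begin

lemma mf_open: "open S"
  and mf_bilinear: "x \<in> S \<Longrightarrow> bilinear (g x)"
  and mf_sym: "x \<in> S \<Longrightarrow> g x a b = g x b a"
  and mf_pos: "x \<in> S \<Longrightarrow> a \<noteq> 0 \<Longrightarrow> g x a a > 0"
  and mf_smooth: "smooth_on S (\<lambda>x. g x a b)"
  using mf unfolding metric_field_def by auto

lemma mf_linear: "x \<in> S \<Longrightarrow> linear (\<lambda>v. g x v w)" "x \<in> S \<Longrightarrow> linear (g x v)"
  using mf_bilinear unfolding bilinear_def by auto

lemma mf_differentiable: "x \<in> S \<Longrightarrow> (\<lambda>y. g y a b) differentiable (at x)"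
  using smooth_on_differentiable mf_smooth by blast

lemma mf_D_linear:
  assumes "x \<in> S"
  shows "linear (\<lambda>v. D (\<lambda>y. g y v w) x u)" "linear (\<lambda>v. D (\<lambda>y. g y w v) x u)" "linear (D (\<lambda>y. g y v w) x)"
  using assms mf_open mf_linear mf_differentiable
  by (auto intro!: linear_D_param linear_frechet_derivative)

lemma koszul_linear: "x \<in> S \<Longrightarrow> linear (koszul g x a b)" "x \<in> S \<Longrightarrow> linear (\<lambda>a. koszul g x a b w)"
  unfolding koszul_def by (intro linear_add_diff mf_D_linear; assumption)+

lemma koszul_sym: "x \<in> S \<Longrightarrow> koszul g x a b w = koszul g x b a w"
proof -
  assume x: "x \<in> S"
  have "D (\<lambda>y. g y a b) x = D (\<lambda>y. g y b a) x"
    by (rule D_cong_on[OF mf_open x]) (rule mf_sym)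
  thus ?thesis unfolding koszul_def by simp
qed

text \<open>Makes the definite description in \<open>chris\<close> meaningful: half the Koszul
  expression is linear in \<open>w\<close>, hence represented by a unique vector.\<close>

lemma chris_ex1:
  assumes "x \<in> S"
  shows "\<exists>!z. \<forall>w. 2 * g x z w = koszul g x a b w"
proof -
  have "linear (\<lambda>w. koszul g x a b w / 2)"
    using linear_add[OF koszul_linear(1)[OF assms]] linear_scale[OF koszul_linear(1)[OF assms]]
    by (auto intro!: linearI simp: add_divide_distrib)
  from form_representation[OF mf_bilinear mf_pos this, OF assms assms]
  show ?thesis by (simp add: field_simps)
qed

lemma chris_eq: "x \<in> S \<Longrightarrow> 2 * g x (chris g x a b) w = koszul g x a b w"
  using theI'[OF chris_ex1] unfolding chris_def by blast

lemma chris_unique: "x \<in> S \<Longrightarrow> (\<And>w. 2 * g x z w = koszul g x a b w) \<Longrightarrow> z = chris g x a b"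
  using chris_ex1[of x a b] chris_eq[of x a b] by blast

lemma chris_sym: "x \<in> S \<Longrightarrow> chris g x a b = chris g x b a"
  using chris_unique[of x "chris g x a b" b a] chris_eq koszul_sym by simp

text \<open>Linearity in the first argument follows from uniqueness in the Koszul formula, linearity
  in the second from symmetry.\<close>

lemma chris_bilinear: assumes x: "x \<in> S" shows "bilinear (chris g x)"
proof -
  have "linear (\<lambda>a. chris g x a b)" for b
    by (rule linearI; rule chris_unique[OF x, symmetric])
      (simp_all add: chris_eq[OF x] distrib_left linear_add[OF mf_linear(1)[OF x]] linear_scale[OF mf_linear(1)[OF x]]
        linear_add[OF koszul_linear(2)[OF x]] linear_scale[OF koszul_linear(2)[OF x]] mult.left_commute)
  moreover from this have "linear (chris g x a)" for a
    by (subst chris_sym[OF x, abs_def])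
  ultimately show ?thesis by (simp add: bilinear_def)
qed

text \<open>Adding the Koszul formulas for \<open>u v w\<close> and \<open>u w v\<close> cancels all
  derivatives except the one along \<open>u\<close>, which occurs twice.\<close>

lemma metric_compat:
  assumes x: "x \<in> S"
  shows "D (\<lambda>y. g y v w) x u = g x (chris g x u v) w + g x v (chris g x u w)"
proof -
  have "D (\<lambda>y. g y v w) x = D (\<lambda>y. g y w v) x"
    by (rule D_cong_on[OF mf_open x]) (rule mf_sym)
  hence "2 * (g x (chris g x u v) w + g x v (chris g x u w)) = 2 * D (\<lambda>y. g y v w) x u"
    using chris_eq[OF x, of u v w] chris_eq[OF x, of u w v] mf_sym[OF x, of v]
    unfolding koszul_def by simp
  thus ?thesis by simp
qed

lemma gram_mult: "x \<in> S \<Longrightarrow> gram g x *v z = (\<chi> i. g x (axis i 1) z)"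
  using linear_axis_expansion[OF mf_linear(2), of x _ z]
  by (simp add: gram_def matrix_vector_mult_def mult.commute)

lemma gram_inverse:
  assumes x: "x \<in> S"
  shows "gram g x ** matrix_inv (gram g x) = mat 1"
proof -
  have "\<exists>B. B ** gram g x = mat 1"
    unfolding matrix_left_invertible_ker
  proof safe
    fix z assume "gram g x *v z = 0"
    hence 0: "g x (axis i 1) z = 0" for i by (simp add: gram_mult[OF x] vec_eq_iff)
    have "g x z z = 0"
      using linear_axis_expansion[OF mf_linear(1)[OF x], of z z] by (simp add: 0)
    thus "z = 0" using mf_pos[OF x, of z] by fastforce
  qed
  then obtain B where "B ** gram g x = mat 1" by blast
  hence "gram g x ** B = mat 1 \<and> B ** gram g x = mat 1" by (simp add: matrix_left_right_inverse)
  thus ?thesis unfolding matrix_inv_def by (rule someI2) blast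
qed

lemma gram_det: "x \<in> S \<Longrightarrow> det (gram g x) \<noteq> 0"
  using arg_cong[OF gram_inverse, of x det] by (auto simp: det_mul)

lemma gram_differentiable: "x \<in> S \<Longrightarrow> (\<lambda>y. gram g y $ i $ j) differentiable (at x)"
  by (simp add: gram_def mf_differentiable)

lemma gram_inverse_differentiable:
  assumes x: "x \<in> S"
  shows "(\<lambda>y. matrix_inv (gram g y) $ i $ j) differentiable (at x)"
proof -
  \<comment> \<open>Column \<open>j\<close> of the inverse solves the Gram system with right-hand
    side \<open>axis j 1\<close>.\<close>
  have "(\<lambda>y. \<chi> i. matrix_inv (gram g y) $ i $ j) differentiable (at x)"
  proof (rule differentiable_linear_solve[OF gram_differentiable _ mf_open])
    fix y assume "y \<in> S"
    from gram_inverse[OF this]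
    show "gram g y *v (\<chi> i. matrix_inv (gram g y) $ i $ j) = axis j 1"
      by (simp add: matrix_matrix_mult_def matrix_vector_mult_def vec_eq_iff mat_def axis_def)
  qed (use x gram_det in auto)
  then show ?thesis
    unfolding differentiable_componentwise_within[of "\<lambda>y. \<chi> i. matrix_inv (gram g y) $ i $ j" x UNIV]
    by (auto simp: Basis_vec_def inner_axis)
qed

text \<open>Tested on the basis vectors, the Koszul formula is a linear system with the Gram matrix,
  whose right-hand side consists of derivatives of smooth functions.\<close>

lemma chris_differentiable:
  assumes x: "x \<in> S"
  shows "(\<lambda>y. chris g y a b) differentiable (at x)"
proof (rule differentiable_linear_solve[OF gram_differentiable _ mf_open])
  show "(\<lambda>y. (\<chi> i. koszul g y a b (axis i 1) / 2) $ i) differentiable (at x)" for i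
    unfolding koszul_def
    using smooth_on_differentiable[OF smooth_on_D[OF mf_smooth] x] by simp
  show "gram g y *v chris g y a b = (\<chi> i. koszul g y a b (axis i 1) / 2)" if "y \<in> S" for y
    using chris_eq[OF that, of a b] mf_sym[OF that] by (simp add: gram_mult[OF that] vec_eq_iff mult.commute)
qed (use x gram_det in auto)

text \<open>With the vectors \<open>E k\<close> as columns of \<open>P\<close>, orthonormality says
  that the transpose of \<open>P\<close> times the Gram matrix times \<open>P\<close> is the
  identity; so the inverse Gram matrix is \<open>P\<close> times its transpose. This links the trace
  over \<open>onb\<close> to \<open>trace_sff\<close>.\<close>

lemma trace_orthonormal:
  fixes E :: "'m \<Rightarrow> real^'m"
  assumes x: "x \<in> S" and E: "\<And>i j. g x (E i) (E j) = (if i = j then 1 else 0)" and bil: "bilinear \<beta>"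
  shows "(\<Sum>k\<in>UNIV. \<beta> (E k) (E k)) = (\<Sum>i\<in>UNIV. \<Sum>j\<in>UNIV. matrix_inv (gram g x) $ i $ j *\<^sub>R \<beta> (axis i 1) (axis j 1))"
proof -
  define P where "P = (\<chi> i k. E k $ i)"
  have lin: "linear (\<lambda>v. \<beta> v w)" "linear (\<beta> v)" for v w
    using bil unfolding bilinear_def by auto
  have 1: "(gram g x ** P) $ i $ k = g x (axis i 1) (E k)" for i k
    using arg_cong[OF gram_mult[OF x, of "E k"], of "\<lambda>v. v $ i"]
    by (simp add: P_def matrix_matrix_mult_def matrix_vector_mult_def)
  have "transpose P ** (gram g x ** P) = mat 1"
  proof -
    have "(transpose P ** (gram g x ** P)) $ i $ k = (\<Sum>j\<in>UNIV. E i $ j * (gram g x ** P) $ j $ k)" for i k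
      by (simp add: matrix_matrix_mult_def[of "transpose P"]) (simp add: transpose_def P_def)
    then have "(transpose P ** (gram g x ** P)) $ i $ k = g x (E i) (E k)" for i k
      unfolding 1 using linear_axis_expansion[OF mf_linear(1)[OF x], of "E i" "E k"] by simp
    thus ?thesis by (simp add: vec_eq_iff E mat_def)
  qed
  hence "gram g x ** (P ** transpose P) = mat 1"
    by (metis matrix_left_right_inverse matrix_mul_assoc)
  hence inv: "matrix_inv (gram g x) = P ** transpose P"
    using gram_inverse[OF x] by (metis matrix_left_right_inverse matrix_mul_assoc matrix_mul_lid matrix_mul_rid)
  have "\<beta> (E k) (E k) = (\<Sum>i\<in>UNIV. \<Sum>j\<in>UNIV. (E k $ i * E k $ j) *\<^sub>R \<beta> (axis i 1) (axis j 1))" for k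
  proof -
    have "\<beta> (E k) (E k) = (\<Sum>i\<in>UNIV. E k $ i *\<^sub>R \<beta> (axis i 1) (E k))"
      by (rule linear_axis_expansion[OF lin(1)])
    also have "\<dots> = (\<Sum>i\<in>UNIV. E k $ i *\<^sub>R (\<Sum>j\<in>UNIV. E k $ j *\<^sub>R \<beta> (axis i 1) (axis j 1)))"
      by (subst linear_axis_expansion[OF lin(2)]) (rule refl)
    finally show ?thesis by (simp add: scaleR_sum_right)
  qed
  hence "(\<Sum>k\<in>UNIV. \<beta> (E k) (E k)) = (\<Sum>k\<in>UNIV. \<Sum>i\<in>UNIV. \<Sum>j\<in>UNIV. (E k $ i * E k $ j) *\<^sub>R \<beta> (axis i 1) (axis j 1))"
    by simp
  also have "\<dots> = (\<Sum>i\<in>UNIV. \<Sum>j\<in>UNIV. \<Sum>k\<in>UNIV. (E k $ i * E k $ j) *\<^sub>R \<beta> (axis i 1) (axis j 1))"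
    by (subst sum.swap) (intro sum.cong refl sum.swap)
  finally show ?thesis
    by (simp add: inv matrix_matrix_mult_def transpose_def P_def scaleR_sum_left)
qed

end

text \<open>The pull-back connection is metric: in the product rule, the derivative of
  \<open>G\<close> itself splits by \<open>metric_compat\<close> into the two Christoffel terms that
  complete \<open>D V\<close> and \<open>D W\<close> to \<open>cov\<close>.\<close>

lemma D_metric_along:
  assumes G: "metric_field U G" and x: "f x \<in> U"
    and d: "f differentiable (at x)" "V differentiable (at x)" "W differentiable (at x)"
  shows "D (\<lambda>y. G (f y) (V y) (W y)) x a
    = G (f x) (cov G f V x a) (W x) + G (f x) (V x) (cov G f W x a)"
proof -
  note d = d[unfolded frechet_derivative_works]
  have "D (\<lambda>y. G (f y) (V y) (W y)) x =
     (\<lambda>h. D (\<lambda>y. G y (V x) (W x)) (f x) (D f x h) + G (f x) (D V x h) (W x) + G (f x) (V x) (D W x h))"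
    by (rule D_eq, rule has_derivative_param_bilinear)
      (use G x d in \<open>auto simp: mf_open mf_bilinear mf_differentiable\<close>)
  thus ?thesis
    by (simp add: cov_def metric_compat[OF G x] linear_add[OF mf_linear(1)[OF G x]] linear_add[OF mf_linear(2)[OF G x]])
qed

section \<open>The second fundamental form of an isometric map in coordinates\<close>

text \<open>The dimensions of source and target are independent, so that the locale covers both the
  coordinate expression of an immersion and the transition map between two charts.\<close>

locale local_isometry =
  fixes S :: "(real^'m::finite) set" and g and U :: "(real^'n::finite) set" and G and f
  assumes g: "metric_field S g" and G: "metric_field U G" and smooth: "smooth_on S f"
    and maps: "x \<in> S \<Longrightarrow> f x \<in> U" and iso: "x \<in> S \<Longrightarrow> g x a b = G (f x) (D f x a) (D f x b)"
begin

lemma linear_D: "x \<in> S \<Longrightarrow> linear (D f x)"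
  using smooth smooth_on_differentiable linear_frechet_derivative by blast

lemma differentiable_D: "x \<in> S \<Longrightarrow> (\<lambda>y. D f y b) differentiable (at x)"
  using smooth smooth_on_differentiable smooth_on_D by blast

lemma has_derivative_D:
  assumes "T x \<in> S" "(T has_derivative T') (at x)" "(V has_derivative V') (at x)"
  shows "((\<lambda>z. D f (T z) (V z)) has_derivative
    (\<lambda>h. D (\<lambda>y. D f y (V x)) (T x) (T' h) + D f (T x) (V' h))) (at x)"
  by (rule has_derivative_param_linear[OF mf_open[OF g]])
    (use assms in \<open>auto intro: linear_D differentiable_D\<close>)

text \<open>Torsion-freeness: second derivatives commute and the Christoffel symbols of the target
  are symmetric.\<close>

lemma cov_D_sym: "x \<in> S \<Longrightarrow> cov G f (\<lambda>y. D f y b) x a = cov G f (\<lambda>y. D f y a) x b"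
  unfolding cov_def
  by (simp add: schwarz[OF smooth mf_open[OF g], of _ b a] chris_sym[OF G maps])

lemma sff_sym: "x \<in> S \<Longrightarrow> sff g G f x a b = sff g G f x b a"
  unfolding sff_def by (simp add: cov_D_sym[of x a b] chris_sym[OF g, of x a b])

lemma cov_D_linear: "x \<in> S \<Longrightarrow> linear (\<lambda>b. cov G f (\<lambda>y. D f y b) x a)"
  unfolding cov_def
  by (intro linear_add_diff linear_D_param[OF mf_open[OF g]] linear_D differentiable_D)
    (use chris_bilinear[OF G maps, of x] linear_compose[OF linear_D, of x "chris G (f x) (D f x a)"]
     in \<open>auto simp: bilinear_def o_def\<close>)

lemma sff_bilinear: assumes x: "x \<in> S" shows "bilinear (sff g G f x)"
proof -
  have "linear (sff g G f x a)" for a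
    unfolding sff_def using chris_bilinear[OF g x] linear_compose[OF _ linear_D[OF x], of "chris g x a"]
    by (intro linear_add_diff cov_D_linear x) (auto simp: bilinear_def o_def)
  moreover from this have "linear (\<lambda>a. sff g G f x a b)" for b
    by (subst sff_sym[OF x])
  ultimately show ?thesis by (simp add: bilinear_def)
qed

text \<open>Substituting the pulled-back metric into the Koszul formula turns its three derivatives
  into six terms; by the symmetry of \<open>K\<close> four of them cancel and the other two
  coincide. The tangential part of \<open>K a b\<close> is therefore the image of the Christoffel
  term of the source.\<close>

lemma sff_normal:
  assumes x: "x \<in> S"
  shows "G (f x) (sff g G f x a b) (D f x w) = 0"
proof -
  define K where "K = (\<lambda>a b. cov G f (\<lambda>y. D f y b) x a)"
  have K_sym: "K a b = K b a" for a b unfolding K_def by (rule cov_D_sym[OF x])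
  have Dg: "D (\<lambda>y. g y b w) x a = G (f x) (K a b) (D f x w) + G (f x) (D f x b) (K a w)" for a b w
  proof -
    have "D (\<lambda>y. g y b w) x = D (\<lambda>y. G (f y) (D f y b) (D f y w)) x"
      by (rule D_cong_on[OF mf_open[OF g] x]) (rule iso)
    then show ?thesis unfolding K_def
      using D_metric_along[OF G maps[OF x] smooth_on_differentiable[OF smooth x] differentiable_D[OF x] differentiable_D[OF x]]
      by simp
  qed
  have "2 * g x (chris g x a b) w = 2 * G (f x) (K a b) (D f x w)"
    unfolding chris_eq[OF g x] koszul_def Dg
    using K_sym[of w a] K_sym[of w b] K_sym[of b a] mf_sym[OF G maps[OF x]] by simp
  hence "G (f x) (K a b) (D f x w) = G (f x) (D f x (chris g x a b)) (D f x w)"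
    by (simp add: iso[OF x])
  thus ?thesis
    unfolding sff_def K_def by (simp add: linear_diff[OF mf_linear(1)[OF G maps[OF x]]])
qed

text \<open>When the derivative is onto, the value is itself in the image, hence orthogonal to
  itself.\<close>

lemma sff_eq_0:
  assumes "x \<in> S" "surj (D f x)"
  shows "sff g G f x a b = 0"
  using sff_normal[OF assms(1), of a b] mf_pos[OF G maps[OF assms(1)]] assms(2)
  by (metis less_irrefl surjD)

lemma chris_transformation:
  assumes "x \<in> S" "surj (D f x)"
  shows "chris G (f x) (D f x a) (D f x b) = D f x (chris g x a b) - D (\<lambda>y. D f y b) x a"
  using sff_eq_0[OF assms, of a b] by (simp add: sff_def cov_def algebra_simps)

lemma sff_differentiable:
  assumes x: "x \<in> S"
  shows "(\<lambda>y. sff g G f y a b) differentiable (at x)"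
  unfolding sff_def cov_def
proof (intro differentiable_add differentiable_diff)
  note d = differentiable_D[OF x, unfolded frechet_derivative_works]
  show "(\<lambda>y. D (\<lambda>y. D f y b) y a) differentiable at x"
    using smooth_on_differentiable[OF smooth_on_D[OF smooth_on_D[OF smooth]] x] .
  have "((\<lambda>z. chris G (f z) (D f z a) (D f z b)) has_derivative
           (\<lambda>h. D (\<lambda>y. chris G y (D f x a) (D f x b)) (f x) (D f x h)
              + chris G (f x) (D (\<lambda>y. D f y a) x h) (D f x b)
              + chris G (f x) (D f x a) (D (\<lambda>y. D f y b) x h))) (at x)"
    by (rule has_derivative_param_bilinear[OF mf_open[OF G] maps[OF x] chris_bilinear[OF G]
          chris_differentiable[OF G maps[OF x]] smooth_on_has_derivative[OF smooth x] d d])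
  thus "(\<lambda>y. chris G (f y) (D f y a) (D f y b)) differentiable at x"
    by (auto simp: differentiable_def)
  show "(\<lambda>y. D f y (chris g y a b)) differentiable at x"
    using has_derivative_D[of "\<lambda>x. x" x, OF x has_derivative_ident chris_differentiable[OF g x, unfolded frechet_derivative_works]]
    by (auto simp: differentiable_def)
qed

text \<open>Guarantees that the derivative of the tension field inside \<open>nabla_tension\<close>
  is a genuine one.\<close>

lemma trace_sff_differentiable: "x \<in> S \<Longrightarrow> trace_sff g G f differentiable (at x)"
  unfolding trace_sff_def[abs_def]
  by (intro differentiable_sum differentiable_scaleR gram_inverse_differentiable[OF g] sff_differentiable finite ballI)

lemma trace_sff_normal: "x \<in> S \<Longrightarrow> G (f x) (trace_sff g G f x) (D f x w) = 0"
  unfolding trace_sff_def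
  by (simp add: linear_sum[OF mf_linear(1)[OF G maps]] linear_scale[OF mf_linear(1)[OF G maps]] sff_normal)

lemma D_cov_trace_sff:
  assumes x: "x \<in> S"
  shows "G (f x) (D f x b) (cov G f (trace_sff g G f) x a) = - G (f x) (sff g G f x a b) (trace_sff g G f x)"
proof -
  let ?\<tau> = "trace_sff g G f"
  have "D (\<lambda>y. G (f y) (?\<tau> y) (D f y b)) x = D (\<lambda>y. 0) x"
    by (rule D_cong_on[OF mf_open[OF g] x]) (rule trace_sff_normal)
  hence "G (f x) (cov G f ?\<tau> x a) (D f x b) + G (f x) (?\<tau> x) (cov G f (\<lambda>y. D f y b) x a) = 0"
    using D_metric_along[OF G maps[OF x] smooth_on_differentiable[OF smooth x] trace_sff_differentiable[OF x] differentiable_D[OF x], of b a]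
    by simp
  \<comment> \<open>The two second arguments differ by a vector in the image of
    \<open>D f x\<close>, which is orthogonal to the trace.\<close>
  moreover have "G (f x) (?\<tau> x) (cov G f (\<lambda>y. D f y b) x a) = G (f x) (?\<tau> x) (sff g G f x a b)"
    unfolding sff_def by (simp add: linear_diff[OF mf_linear(2)[OF G maps[OF x]]] trace_sff_normal[OF x])
  ultimately show ?thesis
    using mf_sym[OF G maps[OF x]] by (simp add: eq_neg_iff_add_eq_0)
qed

end

section \<open>Change of coordinates in the source and in the target\<close>

text \<open>The chain rule for second derivatives produces an extra term, \<open>D f'\<close>
  applied to the second derivative of \<open>T\<close>; the transformation law of the Christoffel
  symbols of the source removes exactly this term.\<close>

lemma sff_reparametrize:
  assumes T: "local_isometry S g S' g' T" and f': "local_isometry S' g' U G f'"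
    and f: "\<And>y. y \<in> S \<Longrightarrow> f y = f' (T y)" and x: "x \<in> S" and surj: "surj (D T x)"
  shows "sff g G f x a b = sff g' G f' (T x) (D T x a) (D T x b)"
proof -
  interpret T: local_isometry S g S' g' T by fact
  interpret f': local_isometry S' g' U G f' by fact
  note op = mf_open[OF T.g]
  have Df: "D f y = (\<lambda>v. D f' (T y) (D T y v))" if y: "y \<in> S" for y
  proof -
    have "D f y = D (\<lambda>y. f' (T y)) y" by (rule D_cong_on[OF op y]) (rule f)
    also have "\<dots> = (\<lambda>v. D f' (T y) (D T y v))"
      by (rule D_eq, rule has_derivative_compose)
        (use smooth_on_has_derivative T.smooth f'.smooth T.maps y in auto)
    finally show ?thesis .
  qed
  have "D (\<lambda>y. D f y b) x = D (\<lambda>y. D f' (T y) (D T y b)) x"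
    by (rule D_cong_on[OF op x]) (simp add: Df)
  also have "\<dots> = (\<lambda>h. D (\<lambda>y. D f' y (D T x b)) (T x) (D T x h) + D f' (T x) (D (\<lambda>y. D T y b) x h))"
    by (rule D_eq, rule f'.has_derivative_D)
      (use x T.maps T.smooth T.differentiable_D smooth_on_has_derivative in \<open>auto simp flip: frechet_derivative_works\<close>)
  finally have "D (\<lambda>y. D f y b) x a = D (\<lambda>y. D f' y (D T x b)) (T x) (D T x a) + D f' (T x) (D (\<lambda>y. D T y b) x a)"
    by simp
  then show ?thesis
    unfolding sff_def cov_def f[OF x] Df[OF x]
    by (simp add: T.chris_transformation[OF x surj] linear_diff[OF f'.linear_D[OF T.maps[OF x]]])
qed

text \<open>Differentiating \<open>D R (f y) (V y)\<close> yields a second derivative of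
  \<open>R\<close>, which cancels against the correction in the transformation law of the
  Christoffel symbols of the target.\<close>

lemma cov_change_target:
  assumes R: "local_isometry U G U' G' R" and x: "f x \<in> U" and surj: "surj (D R (f x))"
    and d: "f differentiable (at x)" "V differentiable (at x)"
  shows "cov G' (\<lambda>y. R (f y)) (\<lambda>y. D R (f y) (V y)) x a = D R (f x) (cov G f V x a)"
proof -
  interpret R: local_isometry U G U' G' R by fact
  note d = d[unfolded frechet_derivative_works]
  have 1: "D (\<lambda>y. D R (f y) (V y)) x = (\<lambda>h. D (\<lambda>y. D R y (V x)) (f x) (D f x h) + D R (f x) (D V x h))"
    by (rule D_eq, rule R.has_derivative_D[OF x d])
  have 2: "D (\<lambda>y. R (f y)) x = (\<lambda>h. D R (f x) (D f x h))"
    by (rule D_eq, rule has_derivative_compose[OF d(1) smooth_on_has_derivative[OF R.smooth x]])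
  show ?thesis
    unfolding cov_def 1 2
    by (simp add: R.chris_transformation[OF x surj] linear_add[OF R.linear_D[OF x]])
qed

section \<open>Passage to manifolds\<close>

lemma cov_cong:
  assumes "open S" "x \<in> S" "\<And>y. y \<in> S \<Longrightarrow> f y = f' y" "\<And>y. y \<in> S \<Longrightarrow> V y = V' y"
  shows "cov G f V x = cov G f' V' x"
  unfolding cov_def using D_cong_on[OF assms(1-3)] D_cong_on[OF assms(1,2,4)] assms(2-4) by auto

lemma metric_field_subset: "metric_field S g \<Longrightarrow> open T \<Longrightarrow> T \<subseteq> S \<Longrightarrow> metric_field T g"
  unfolding metric_field_def using smooth_on_subset by blast

abbreviation transition :: "('a, 'm::finite) chart \<Rightarrow> ('a, 'm) chart \<Rightarrow> real^'m \<Rightarrow> real^'m" where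
  "transition c c' \<equiv> snd c' \<circ> chart_inv c"

section \<open>Charts, transition maps and tangent vectors\<close>

locale smooth_mfd =
  fixes M :: "('a, 'm::finite) manifold"
  assumes manifold: "smooth_manifold M"
begin

lemma charts_atD: "c \<in> charts_at M p \<Longrightarrow> c \<in> atlas M" "c \<in> charts_at M p \<Longrightarrow> p \<in> fst c"
  by (auto simp: charts_at_def)

lemma is_chart: "c \<in> atlas M \<Longrightarrow> is_chart (carrier_top M) c"
  using manifold by (auto simp: smooth_manifold_def)

lemma chart_subset: "c \<in> atlas M \<Longrightarrow> fst c \<subseteq> points M"
  using is_chart openin_subset unfolding is_chart_def by blast

lemma charts_at_points: "c \<in> charts_at M p \<Longrightarrow> p \<in> points M"
  using charts_atD chart_subset by blast

lemma chart_at: "p \<in> points M \<Longrightarrow> chart_at M p \<in> charts_at M p"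
proof -
  assume "p \<in> points M"
  then obtain c where "c \<in> atlas M" "p \<in> fst c"
    using manifold unfolding smooth_manifold_def by blast
  then have "c \<in> charts_at M p" by (simp add: charts_at_def)
  then show ?thesis unfolding chart_at_def by (rule someI)
qed

lemma chart_inj: assumes "c \<in> atlas M" shows "inj_on (snd c) (fst c)"
proof -
  have "topspace (subtopology (carrier_top M) (fst c)) = fst c"
    using chart_subset[OF assms] by auto
  with is_chart[OF assms] show ?thesis
    unfolding is_chart_def by (metis homeomorphic_map_def homeomorphic_eq_everything_map)
qed

lemma chart_inv_left: "c \<in> atlas M \<Longrightarrow> p \<in> fst c \<Longrightarrow> chart_inv c (snd c p) = p"
  unfolding chart_inv_def using chart_inj by simp

lemma chart_open:
  assumes c: "c \<in> atlas M" and W: "openin (carrier_top M) W" "W \<subseteq> fst c"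
  shows "open (snd c ` W)"
proof -
  have "open_map (subtopology (carrier_top M) (fst c)) (top_of_set (snd c ` fst c)) (snd c)"
    using is_chart[OF c] by (simp add: is_chart_def homeomorphic_eq_everything_map)
  moreover have "openin (subtopology (carrier_top M) (fst c)) W"
    using W by (auto simp: openin_subtopology)
  ultimately have "openin (top_of_set (snd c ` fst c)) (snd c ` W)"
    unfolding open_map_def by blast
  with is_chart[OF c] show ?thesis
    unfolding is_chart_def using openin_open_trans by blast
qed

lemma chart_openin: "c \<in> atlas M \<Longrightarrow> openin (carrier_top M) (fst c)"
  using is_chart by (simp add: is_chart_def)

lemma overlap_open: "c \<in> atlas M \<Longrightarrow> c' \<in> atlas M \<Longrightarrow> open (snd c ` (fst c \<inter> fst c'))"
  by (intro chart_open) (auto simp: chart_openin)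

lemma trans_smooth: "c \<in> atlas M \<Longrightarrow> c' \<in> atlas M \<Longrightarrow> smooth_on (snd c ` (fst c \<inter> fst c')) (transition c c')"
  using manifold by (auto simp: smooth_manifold_def)

lemma trans_has_derivative:
  assumes "c \<in> charts_at M p" "c' \<in> charts_at M p"
  shows "(transition c c' has_derivative D (transition c c') (snd c p)) (at (snd c p))"
  by (rule smooth_on_has_derivative[OF trans_smooth]) (use assms charts_atD in auto)

lemma trans_linear: "c \<in> charts_at M p \<Longrightarrow> c' \<in> charts_at M p \<Longrightarrow> linear (D (transition c c') (snd c p))"
  using trans_has_derivative has_derivative_linear by blast

lemma trans_apply: "c \<in> charts_at M p \<Longrightarrow> transition c c' (snd c p) = snd c' p"
  using charts_atD chart_inv_left by simp

text \<open>Chain rule on the overlap of the charts. It transfers differentiability as well, which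
  is what allows a hypothesis in a convenient chart to control \<open>dir_deriv\<close>, computed in
  an unknown one.\<close>

lemma D_change_chart:
  assumes c: "c \<in> charts_at M p" "c' \<in> charts_at M p"
    and f: "(f \<circ> chart_inv c') differentiable (at (snd c' p))"
  shows "((f \<circ> chart_inv c) has_derivative (\<lambda>v. D (f \<circ> chart_inv c') (snd c' p) (D (transition c c') (snd c p) v))) (at (snd c p))"
proof (rule has_derivative_transform_within_open)
  show "((\<lambda>x. (f \<circ> chart_inv c') (transition c c' x)) has_derivative (\<lambda>v. D (f \<circ> chart_inv c') (snd c' p) (D (transition c c') (snd c p) v))) (at (snd c p))"
    by (rule has_derivative_compose[OF trans_has_derivative[OF c]])
      (simp only: trans_apply[OF c(1)] f[unfolded frechet_derivative_works])
  show "open (snd c ` (fst c \<inter> fst c'))" using c charts_atD by (blast intro: overlap_open)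
  show "snd c p \<in> snd c ` (fst c \<inter> fst c')" using c charts_atD by blast
  fix x assume "x \<in> snd c ` (fst c \<inter> fst c')"
  then show "(f \<circ> chart_inv c') (transition c c' x) = (f \<circ> chart_inv c) x"
    using charts_atD(1)[OF c(1)] charts_atD(1)[OF c(2)] chart_inv_left[of c] chart_inv_left[of c'] by auto
qed

lemma trans_chain:
  assumes "c \<in> charts_at M p" "c' \<in> charts_at M p" "c'' \<in> charts_at M p"
  shows "D (transition c c'') (snd c p) v = D (transition c' c'') (snd c' p) (D (transition c c') (snd c p) v)"
  using D_eq[OF D_change_chart[OF assms(1,2), of "snd c''", OF differentiableI[OF trans_has_derivative[OF assms(2,3)]]]]
  by simp

lemma trans_self: assumes c: "c \<in> charts_at M p" shows "D (transition c c) (snd c p) v = v"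
proof -
  have "D (transition c c) (snd c p) = D (\<lambda>x. x) (snd c p)"
    by (rule D_cong_on[OF overlap_open[of c c]])
      (use charts_atD[OF c] chart_inv_left[of c] in auto)
  thus ?thesis by simp
qed

text \<open>The derivative of the reverse transition is a right inverse. This supplies the
  surjectivity that the transformation law of the Christoffel symbols asks for.\<close>

lemma trans_surj:
  assumes "c \<in> charts_at M p" "c' \<in> charts_at M p"
  shows "surj (D (transition c c') (snd c p))"
  by (rule surjI[of _ "D (transition c' c) (snd c' p)"])
    (simp add: trans_chain[OF assms(2,1,2), symmetric] trans_self[OF assms(2)])

lemma coord_vec_apply: "c' \<in> charts_at M p \<Longrightarrow> coord_vec M c p a c' = D (transition c c') (snd c p) a"
  by (simp add: coord_vec_def)

lemma coord_vec_self: "c \<in> charts_at M p \<Longrightarrow> coord_vec M c p a c = a"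
  by (simp add: coord_vec_apply trans_self)

lemma coord_vec_tangent: "c \<in> charts_at M p \<Longrightarrow> coord_vec M c p a \<in> tangent_space M p"
  unfolding tangent_space_def coord_vec_def by (auto intro: trans_chain)

lemma tangent_trans:
  "v \<in> tangent_space M p \<Longrightarrow> c \<in> charts_at M p \<Longrightarrow> c' \<in> charts_at M p \<Longrightarrow> v c' = D (transition c c') (snd c p) (v c)"
  unfolding tangent_space_def by blast

lemma tangent_outside: "v \<in> tangent_space M p \<Longrightarrow> c \<notin> charts_at M p \<Longrightarrow> v c = 0"
  unfolding tangent_space_def by blast

lemma tangentI:
  assumes "\<And>c c'. c \<in> charts_at M p \<Longrightarrow> c' \<in> charts_at M p \<Longrightarrow> v c' = D (transition c c') (snd c p) (v c)"
    and "\<And>c. c \<notin> charts_at M p \<Longrightarrow> v c = 0"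
  shows "v \<in> tangent_space M p"
  using assms unfolding tangent_space_def by blast

lemma coord_vec_tangent_id:
  assumes "v \<in> tangent_space M p" "c \<in> charts_at M p"
  shows "coord_vec M c p (v c) = v"
  using tangent_trans[OF assms] tangent_outside[OF assms(1)] by (metis coord_vec_def ext)

lemma coord_vec_linear:
  "c \<in> charts_at M p \<Longrightarrow> coord_vec M c p (r *\<^sub>R a + b) = (\<lambda>c'. r *\<^sub>R coord_vec M c p a c' + coord_vec M c p b c')"
  by (rule ext) (simp add: coord_vec_def linear_add[OF trans_linear] linear_scale[OF trans_linear])

lemma tangent_diff:
  assumes "u \<in> tangent_space M p" "v \<in> tangent_space M p"
  shows "(\<lambda>c. u c - v c) \<in> tangent_space M p"
proof (rule tangentI)
  fix c c' assume c: "c \<in> charts_at M p" "c' \<in> charts_at M p"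
  show "u c' - v c' = D (transition c c') (snd c p) (u c - v c)"
    unfolding linear_diff[OF trans_linear[OF c]]
    by (rule arg_cong2[OF tangent_trans[OF assms(1) c] tangent_trans[OF assms(2) c]])
next
  fix c assume c: "c \<notin> charts_at M p"
  show "u c - v c = 0" using tangent_outside[OF assms(1) c] tangent_outside[OF assms(2) c] by simp
qed

lemma tangent_sum:
  assumes "\<And>i. i \<in> I \<Longrightarrow> u i \<in> tangent_space M p"
  shows "(\<lambda>c. \<Sum>i\<in>I. u i c) \<in> tangent_space M p"
proof (rule tangentI)
  fix c c' assume c: "c \<in> charts_at M p" "c' \<in> charts_at M p"
  show "(\<Sum>i\<in>I. u i c') = D (transition c c') (snd c p) (\<Sum>i\<in>I. u i c)"
    unfolding linear_sum[OF trans_linear[OF c]]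
    by (rule sum.cong[OF refl], rule tangent_trans[OF assms c])
qed (simp add: tangent_outside[OF assms])

text \<open>Frees \<open>dir_deriv\<close> from the chart \<open>chart_at\<close> built into its
  definition.\<close>

lemma dir_deriv_eq:
  assumes v: "v \<in> tangent_space M p" and c: "c \<in> charts_at M p"
    and f: "(f \<circ> chart_inv c) differentiable (at (snd c p))"
  shows "dir_deriv M p v f = D (f \<circ> chart_inv c) (snd c p) (v c)"
proof -
  have c0: "chart_at M p \<in> charts_at M p" using chart_at charts_at_points[OF c] by blast
  show ?thesis
    unfolding dir_deriv_def Let_def D_eq[OF D_change_chart[OF c0 c f]] tangent_trans[OF v c0 c] ..
qed

end

section \<open>Riemannian metrics read in charts\<close>

locale riemannian = smooth_mfd M for M :: "('a, 'm::finite) manifold" +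
  assumes riemannian: "riemannian_manifold M"
begin

abbreviation \<gamma> where "\<gamma> c \<equiv> metric_coord M c"

lemma metric_sym:
  assumes "p \<in> points M" "u \<in> tangent_space M p" "v \<in> tangent_space M p"
  shows "metric M p u v = metric M p v u"
  using riemannian assms unfolding riemannian_manifold_def by blast

lemma metric_linear:
  assumes "p \<in> points M" "u \<in> tangent_space M p" "v \<in> tangent_space M p" "w \<in> tangent_space M p"
  shows "metric M p (\<lambda>c. r *\<^sub>R u c + v c) w = r * metric M p u w + metric M p v w"
  using riemannian assms unfolding riemannian_manifold_def by blast

lemma metric_pos:
  assumes "p \<in> points M" "u \<in> tangent_space M p" "u \<noteq> (\<lambda>_. 0)"
  shows "metric M p u u > 0"
  using riemannian assms unfolding riemannian_manifold_def by blast

lemma metric_eq: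
  assumes "u \<in> tangent_space M p" "v \<in> tangent_space M p" "c \<in> charts_at M p"
  shows "metric M p u v = \<gamma> c (snd c p) (u c) (v c)"
  using assms charts_atD chart_inv_left by (simp add: metric_coord_def coord_vec_tangent_id)

lemma metric_coord_at:
  "c \<in> charts_at M p \<Longrightarrow> \<gamma> c (snd c p) a b = metric M p (coord_vec M c p a) (coord_vec M c p b)"
  using charts_atD chart_inv_left by (simp add: metric_coord_def)

lemma metric_field_chart:
  assumes c: "c \<in> atlas M"
  shows "metric_field (snd c ` fst c) (\<gamma> c)"
  unfolding metric_field_def
proof safe
  show "open (snd c ` fst c)" using chart_open c chart_openin by blast
  show "smooth_on (snd c ` fst c) (\<lambda>x. \<gamma> c x a b)" for a b
    using riemannian c by (auto simp: riemannian_manifold_def)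
  fix p assume "p \<in> fst c"
  then have p: "c \<in> charts_at M p" using c by (simp add: charts_at_def)
  note pt = charts_at_points[OF p] and tv = coord_vec_tangent[OF p]
  note eq = metric_coord_at[OF p]
  show sym: "\<gamma> c (snd c p) a b = \<gamma> c (snd c p) b a" for a b
    unfolding eq by (rule metric_sym[OF pt tv tv])
  show "\<gamma> c (snd c p) a a > 0" if "a \<noteq> 0" for a
    unfolding eq using coord_vec_self[OF p, of a] that by (intro metric_pos[OF pt tv]) auto
  have lin: "\<gamma> c (snd c p) (r *\<^sub>R a + b) w = r * \<gamma> c (snd c p) a w + \<gamma> c (snd c p) b w" for r a b w
    unfolding eq coord_vec_linear[OF p] by (rule metric_linear[OF pt tv tv tv])
  have lin1: "linear (\<lambda>a. \<gamma> c (snd c p) a w)" for w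
  proof (rule linearI)
    \<comment> \<open>Linearity is given as a single combined rule: coefficient 1 yields additivity,
      additivity yields the value at 0, and a zero second summand yields homogeneity.\<close>
    show add: "\<gamma> c (snd c p) (a + b) w = \<gamma> c (snd c p) a w + \<gamma> c (snd c p) b w" for a b
      using lin[of 1 a b] by simp
    have "\<gamma> c (snd c p) 0 w = 0" using add[of 0 0] by simp
    then show "\<gamma> c (snd c p) (r *\<^sub>R a) w = r *\<^sub>R \<gamma> c (snd c p) a w" for r a
      using lin[of r a 0] by simp
  qed
  have "linear (\<gamma> c (snd c p) w)" for w
  proof -
    have eq: "\<gamma> c (snd c p) w = (\<lambda>a. \<gamma> c (snd c p) a w)" by (rule ext) (rule sym)
    show ?thesis by (subst eq) (rule lin1)
  qed
  with lin1 show "bilinear (\<gamma> c (snd c p))" by (simp add: bilinear_def)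
qed

text \<open>Both coordinate forms express the same metric on the manifold, so the results on
  isometric maps apply to every change of chart.\<close>

lemma trans_isometry:
  assumes c: "c \<in> atlas M" "c' \<in> atlas M"
  shows "local_isometry (snd c ` (fst c \<inter> fst c')) (\<gamma> c) (snd c' ` fst c') (\<gamma> c') (transition c c')"
proof
  show "metric_field (snd c ` (fst c \<inter> fst c')) (\<gamma> c)"
    using metric_field_subset[OF metric_field_chart[OF c(1)] overlap_open[OF c]] by blast
  show "metric_field (snd c' ` fst c') (\<gamma> c')" using metric_field_chart c by blast
  show "smooth_on (snd c ` (fst c \<inter> fst c')) (transition c c')" by (rule trans_smooth[OF c])
  fix x assume "x \<in> snd c ` (fst c \<inter> fst c')"
  then obtain p where x: "x = snd c p" and p: "c \<in> charts_at M p" "c' \<in> charts_at M p"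
    using c by (auto simp: charts_at_def)
  show "transition c c' x \<in> snd c' ` fst c'"
    unfolding x trans_apply[OF p(1)] using charts_atD p by blast
  show "\<gamma> c x a b = \<gamma> c' (transition c c' x) (D (transition c c') x a) (D (transition c c') x b)" for a b
    unfolding x trans_apply[OF p(1)] metric_coord_at[OF p(1)]
    using metric_eq[OF coord_vec_tangent[OF p(1)] coord_vec_tangent[OF p(1)] p(2)]
    by (simp add: coord_vec_apply[OF p(2)])
qed

text \<open>Shows that the choice in \<open>onb\<close> succeeds, by carrying an orthonormal basis
  of the coordinate form over to the tangent space.\<close>

lemma is_onb_onb: assumes p: "p \<in> points M" shows "is_onb M p (onb M p)"
proof -
  define c where "c = chart_at M p"
  have c: "c \<in> charts_at M p" unfolding c_def by (rule chart_at[OF p])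
  have x: "snd c p \<in> snd c ` fst c" using c charts_atD by blast
  note mf = metric_field_chart[OF charts_atD(1)[OF c]]
  have "\<exists>E. \<forall>i j. \<gamma> c (snd c p) (E i) (E j) = (if i = (j::'m) then 1 else 0)"
    by (rule exists_orthonormal[OF mf_bilinear[OF mf x] mf_sym[OF mf x] mf_pos[OF mf x]])
  then obtain E where "\<And>i j. \<gamma> c (snd c p) (E i) (E j) = (if i = (j::'m) then 1 else 0)" by blast
  then have "is_onb M p (\<lambda>i. coord_vec M c p (E i))"
    by (simp add: is_onb_def coord_vec_tangent[OF c] metric_coord_at[OF c])
  then show ?thesis unfolding onb_def by (rule someI[of "is_onb M p"])
qed

lemma onb_tangent: "p \<in> points M \<Longrightarrow> onb M p i \<in> tangent_space M p"
  using is_onb_onb by (simp add: is_onb_def)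

lemma onb_orthonormal: "p \<in> points M \<Longrightarrow> metric M p (onb M p i) (onb M p j) = (if i = j then 1 else 0)"
  using is_onb_onb by (simp add: is_onb_def)

lemma metric_sum_left:
  assumes p: "p \<in> points M" and u: "\<And>i. i \<in> I \<Longrightarrow> u i \<in> tangent_space M p" and w: "w \<in> tangent_space M p"
  shows "metric M p (\<lambda>c. \<Sum>i\<in>I. u i c) w = (\<Sum>i\<in>I. metric M p (u i) w)"
proof -
  note c = chart_at[OF p]
  have x: "snd (chart_at M p) p \<in> snd (chart_at M p) ` fst (chart_at M p)" using c charts_atD by blast
  note mf = metric_field_chart[OF charts_atD(1)[OF c]]
  show ?thesis
    by (simp add: metric_eq[OF tangent_sum[OF u] w c] metric_eq[OF u w c] linear_sum[OF mf_linear(1)[OF mf x]])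
qed

lemma metric_nonneg:
  assumes p: "p \<in> points M" and u: "u \<in> tangent_space M p"
  shows "metric M p u u \<ge> 0"
proof (cases "u = (\<lambda>_. 0)")
  case True
  \<comment> \<open>The zero vector is treated as an empty sum.\<close>
  then show ?thesis using metric_sum_left[OF p, of "{}" "\<lambda>_. u"] u by simp
qed (use metric_pos[OF p u] in simp)

end

lemma riemannian_locale: "riemannian_manifold M \<Longrightarrow> riemannian M"
  by unfold_locales (auto simp: riemannian_manifold_def)

section \<open>The immersion read in charts\<close>

locale immersion = M: riemannian M + N: riemannian N
  for M :: "('a, 'm::finite) manifold" and N :: "('b, 'n::finite) manifold" +
  fixes \<phi> :: "'a \<Rightarrow> 'b"
  assumes immersion: "riemannian_immersion M N \<phi>"
begin

definition rep where "rep c d = snd d \<circ> \<phi> \<circ> chart_inv c"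

definition rep_dom where "rep_dom c d = snd c ` {p \<in> fst c. \<phi> p \<in> fst d}"

lemma smooth_map: "smooth_map M N \<phi>"
  using immersion by (simp add: riemannian_immersion_def)

lemma map_points: "p \<in> points M \<Longrightarrow> \<phi> p \<in> points N"
  using smooth_map by (auto simp: smooth_map_def continuous_map_def)

lemma rep_dom_openin:
  assumes "c \<in> atlas M" "d \<in> atlas N"
  shows "openin (carrier_top M) {p \<in> fst c. \<phi> p \<in> fst d}"
proof -
  have "{p \<in> fst c. \<phi> p \<in> fst d} = {p \<in> points M. \<phi> p \<in> fst d} \<inter> fst c"
    using M.chart_subset[OF assms(1)] by auto
  then show ?thesis
    using openin_continuous_map_preimage[of "carrier_top M" "carrier_top N" \<phi> "fst d"] smooth_map
      N.chart_openin[OF assms(2)] M.chart_openin[OF assms(1)]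
    by (auto simp: smooth_map_def)
qed

lemma rep_dom_open: "c \<in> atlas M \<Longrightarrow> d \<in> atlas N \<Longrightarrow> open (rep_dom c d)"
  unfolding rep_dom_def by (rule M.chart_open[OF _ rep_dom_openin]) auto

lemma rep_smooth: "c \<in> atlas M \<Longrightarrow> d \<in> atlas N \<Longrightarrow> smooth_on (rep_dom c d) (rep c d)"
  using smooth_map unfolding smooth_map_def rep_dom_def rep_def by blast

lemma rep_dom_cases:
  assumes "x \<in> rep_dom c d" "c \<in> atlas M" "d \<in> atlas N"
  obtains q where "x = snd c q" "c \<in> charts_at M q" "d \<in> charts_at N (\<phi> q)"
  using assms by (auto simp: rep_dom_def charts_at_def)

lemma in_dom: "c \<in> charts_at M p \<Longrightarrow> d \<in> charts_at N (\<phi> p) \<Longrightarrow> snd c p \<in> rep_dom c d"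
  by (auto simp: rep_dom_def charts_at_def)

lemma rep_apply: "c \<in> charts_at M p \<Longrightarrow> rep c d (snd c p) = snd d (\<phi> p)"
  by (simp add: rep_def M.chart_inv_left[OF M.charts_atD])

lemma rep_has_derivative:
  assumes "c \<in> charts_at M p" "d \<in> charts_at N (\<phi> p)"
  shows "(rep c d has_derivative D (rep c d) (snd c p)) (at (snd c p))"
  using smooth_on_has_derivative[OF rep_smooth in_dom] assms M.charts_atD N.charts_atD by blast

lemma rep_differentiable:
  "c \<in> charts_at M p \<Longrightarrow> d \<in> charts_at N (\<phi> p) \<Longrightarrow> rep c d differentiable (at (snd c p))"
  using rep_has_derivative differentiable_def by blast

lemma differential_eq:
  assumes "c \<in> charts_at M p" "d \<in> charts_at N (\<phi> p)" "u \<in> tangent_space M p"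
  shows "differential M N \<phi> p u d = D (rep c d) (snd c p) (u c)"
  using M.dir_deriv_eq[OF assms(3,1), of "snd d \<circ> \<phi>"] rep_differentiable[OF assms(1,2)] assms(2)
  by (simp add: differential_def rep_def)

lemma rep_trans:
  assumes d: "d \<in> atlas N" "d' \<in> atlas N" and c: "c \<in> atlas M"
    and x: "x \<in> rep_dom c d \<inter> rep_dom c d'"
  shows "rep c d' x = transition d d' (rep c d x)"
proof -
  obtain q where "x = snd c q" "c \<in> charts_at M q" "d \<in> charts_at N (\<phi> q)"
    using rep_dom_cases[OF _ c d(1)] x by blast
  then show ?thesis by (simp add: rep_apply N.chart_inv_left[OF N.charts_atD])
qed

lemma D_rep_trans:
  assumes c: "c \<in> charts_at M p" and d: "d \<in> charts_at N (\<phi> p)" "d' \<in> charts_at N (\<phi> p)"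
  shows "D (rep c d') (snd c p) v = D (transition d d') (snd d (\<phi> p)) (D (rep c d) (snd c p) v)"
proof -
  have at: "c \<in> atlas M" "d \<in> atlas N" "d' \<in> atlas N" using c d M.charts_atD N.charts_atD by auto
  have "D (rep c d') (snd c p) = D (\<lambda>x. transition d d' (rep c d x)) (snd c p)"
    by (rule D_cong_on[OF open_Int[OF rep_dom_open[OF at(1,2)] rep_dom_open[OF at(1,3)]]
          IntI[OF in_dom[OF c d(1)] in_dom[OF c d(2)]] rep_trans[OF at(2,3,1)]])
  also have "\<dots> = (\<lambda>v. D (transition d d') (snd d (\<phi> p)) (D (rep c d) (snd c p) v))"
    by (rule D_eq, rule has_derivative_compose[OF rep_has_derivative[OF c d(1)]])
      (simp only: rep_apply[OF c] N.trans_has_derivative[OF d])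
  finally show ?thesis by simp
qed

lemma differential_tangent:
  assumes p: "p \<in> points M"
  shows "differential M N \<phi> p w \<in> tangent_space N (\<phi> p)"
proof (rule N.tangentI)
  fix d d' assume d: "d \<in> charts_at N (\<phi> p)" "d' \<in> charts_at N (\<phi> p)"
  have "dir_deriv M p w (snd d' \<circ> \<phi>) = D (transition d d') (snd d (\<phi> p)) (dir_deriv M p w (snd d \<circ> \<phi>))"
    using D_rep_trans[OF M.chart_at[OF p] d] by (simp add: dir_deriv_def Let_def rep_def)
  then show "differential M N \<phi> p w d' = D (transition d d') (snd d (\<phi> p)) (differential M N \<phi> p w d)"
    using d by (simp add: differential_def)
qed (simp add: differential_def)

lemma metric_differential:
  "p \<in> points M \<Longrightarrow> u \<in> tangent_space M p \<Longrightarrow> v \<in> tangent_space M p \<Longrightarrow>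
    metric M p u v = metric N (\<phi> p) (differential M N \<phi> p u) (differential M N \<phi> p v)"
  using immersion by (simp add: riemannian_immersion_def)

text \<open>Entry point for the coordinate results: every pair of charts turns the immersion into an
  instance of \<open>local_isometry\<close>.\<close>

lemma rep_isometry:
  assumes at: "c \<in> atlas M" "d \<in> atlas N"
  shows "local_isometry (rep_dom c d) (M.\<gamma> c) (snd d ` fst d) (N.\<gamma> d) (rep c d)"
proof
  show "metric_field (rep_dom c d) (M.\<gamma> c)"
    using metric_field_subset[OF M.metric_field_chart[OF at(1)] rep_dom_open[OF at]] by (auto simp: rep_dom_def)
  show "metric_field (snd d ` fst d) (N.\<gamma> d)" by (rule N.metric_field_chart[OF at(2)])
  show "smooth_on (rep_dom c d) (rep c d)" by (rule rep_smooth[OF at])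
  fix x assume "x \<in> rep_dom c d"
  then obtain p where x: "x = snd c p" and c: "c \<in> charts_at M p" and d: "d \<in> charts_at N (\<phi> p)"
    using rep_dom_cases at by blast
  show "rep c d x \<in> snd d ` fst d"
    unfolding x rep_apply[OF c] using N.charts_atD[OF d] by blast
  note p = M.charts_at_points[OF c] and tv = M.coord_vec_tangent[OF c]
  show "M.\<gamma> c x a b = N.\<gamma> d (rep c d x) (D (rep c d) x a) (D (rep c d) x b)" for a b
    unfolding x rep_apply[OF c] M.metric_coord_at[OF c] metric_differential[OF p tv tv]
      N.metric_eq[OF differential_tangent[OF p] differential_tangent[OF p] d]
    by (simp add: differential_eq[OF c d tv] M.coord_vec_self[OF c])
qed

lemma pullback_conn_eq:
  assumes c: "c \<in> charts_at M p" and d: "d \<in> charts_at N (\<phi> p)" and u: "u \<in> tangent_space M p"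
    and V: "(\<lambda>x. V (chart_inv c x) d) differentiable (at (snd c p))"
  shows "pullback_conn M N \<phi> p u V d = cov (N.\<gamma> d) (rep c d) (\<lambda>x. V (chart_inv c x) d) (snd c p) (u c)"
  using M.dir_deriv_eq[OF u c, of "\<lambda>q. V q d"] V d
  by (simp add: pullback_conn_def cov_def christoffel_def chris_def koszul_def o_def rep_apply[OF c]
      differential_eq[OF c d u] M.chart_inv_left[OF M.charts_atD[OF c]])

text \<open>Neither summand of the pull-back connection transforms as a vector, but their sum does,
  by \<open>cov_change_target\<close> for the transition map of the target charts.\<close>

lemma pullback_conn_tangent:
  assumes c: "c \<in> charts_at M p" and u: "u \<in> tangent_space M p"
    and tv: "\<And>q. q \<in> points M \<Longrightarrow> V q \<in> tangent_space N (\<phi> q)"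
    and V: "\<And>d. d \<in> charts_at N (\<phi> p) \<Longrightarrow> (\<lambda>x. V (chart_inv c x) d) differentiable (at (snd c p))"
  shows "pullback_conn M N \<phi> p u V \<in> tangent_space N (\<phi> p)"
proof (rule N.tangentI)
  fix d d' assume d: "d \<in> charts_at N (\<phi> p)" "d' \<in> charts_at N (\<phi> p)"
  have at: "c \<in> atlas M" "d \<in> atlas N" "d' \<in> atlas N" using c d M.charts_atD N.charts_atD by auto
  let ?x = "snd c p" and ?V = "\<lambda>d x. V (chart_inv c x) d"
  \<comment> \<open>\<open>cov\<close> differentiates, so the transformation of \<open>V\<close>
    must be known on a neighbourhood of the point; this is why tangency of \<open>V\<close> is
    assumed at all points.\<close>
  have 1: "cov (N.\<gamma> d') (rep c d') (?V d') ?x =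
      cov (N.\<gamma> d') (\<lambda>x. transition d d' (rep c d x)) (\<lambda>x. D (transition d d') (rep c d x) (?V d x)) ?x"
  proof (rule cov_cong)
    show "open (rep_dom c d \<inter> rep_dom c d')" "?x \<in> rep_dom c d \<inter> rep_dom c d'"
      using at in_dom[OF c] d by (simp_all add: open_Int rep_dom_open)
    fix x assume x: "x \<in> rep_dom c d \<inter> rep_dom c d'"
    show "rep c d' x = transition d d' (rep c d x)" by (rule rep_trans[OF at(2,3,1) x])
    obtain q where q: "x = snd c q" "q \<in> fst c" "\<phi> q \<in> fst d"
      using x by (auto simp: rep_dom_def)
    moreover obtain q' where q': "x = snd c q'" "q' \<in> fst c" "\<phi> q' \<in> fst d'"
      using x by (auto simp: rep_dom_def)
    moreover have "q' = q" using q q' M.chart_inv_left[OF at(1)] by metis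
    ultimately have q: "x = snd c q" "c \<in> charts_at M q" "d \<in> charts_at N (\<phi> q)" "d' \<in> charts_at N (\<phi> q)"
      using at by (auto simp: charts_at_def)
    show "?V d' x = D (transition d d') (rep c d x) (?V d x)"
      unfolding q(1) rep_apply[OF q(2)] M.chart_inv_left[OF M.charts_atD[OF q(2)]]
      by (rule N.tangent_trans[OF tv[OF M.charts_at_points[OF q(2)]] q(3,4)])
  qed
  have 2: "cov (N.\<gamma> d') (\<lambda>x. transition d d' (rep c d x)) (\<lambda>x. D (transition d d') (rep c d x) (?V d x)) ?x (u c)
      = D (transition d d') (rep c d ?x) (cov (N.\<gamma> d) (rep c d) (?V d) ?x (u c))"
  proof (rule cov_change_target[OF N.trans_isometry[OF at(2,3)] _ _ rep_differentiable[OF c d(1)] V[OF d(1)]])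
    show "rep c d ?x \<in> snd d ` (fst d \<inter> fst d')"
      unfolding rep_apply[OF c] using d N.charts_atD by blast
    show "surj (D (transition d d') (rep c d ?x))"
      unfolding rep_apply[OF c] by (rule N.trans_surj[OF d])
  qed
  show "pullback_conn M N \<phi> p u V d' = D (transition d d') (snd d (\<phi> p)) (pullback_conn M N \<phi> p u V d)"
    unfolding pullback_conn_eq[where V = V, OF c d(1) u V[OF d(1)]]
      pullback_conn_eq[where V = V, OF c d(2) u V[OF d(2)]] 1 2 rep_apply[OF c] ..
qed (simp add: pullback_conn_def)

section \<open>The second fundamental form and the tension field on the manifold\<close>

abbreviation B where "B \<equiv> second_fund M N \<phi>"

abbreviation \<tau> where "\<tau> \<equiv> tension M N \<phi>"

lemma differential_coord_field:
  assumes c: "c \<in> atlas M" and d: "d \<in> atlas N" and x: "x \<in> rep_dom c d"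
  shows "differential M N \<phi> (chart_inv c x) (coord_vec M c (chart_inv c x) b) d = D (rep c d) x b"
proof -
  obtain q where q: "x = snd c q" "c \<in> charts_at M q" "d \<in> charts_at N (\<phi> q)"
    by (rule rep_dom_cases[OF x c d])
  show ?thesis
    by (simp add: q(1) M.chart_inv_left[OF M.charts_atD[OF q(2)]] differential_eq[OF q(2,3) M.coord_vec_tangent[OF q(2)]]
        M.coord_vec_self[OF q(2)])
qed

lemma differential_coord_field_differentiable:
  assumes c: "c \<in> charts_at M p" and d: "d \<in> charts_at N (\<phi> p)"
  shows "(\<lambda>x. differential M N \<phi> (chart_inv c x) (coord_vec M c (chart_inv c x) b) d) differentiable (at (snd c p))"
proof -
  have at: "c \<in> atlas M" "d \<in> atlas N" using c d M.charts_atD N.charts_atD by auto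
  show ?thesis
    by (rule differentiable_transform_open[OF local_isometry.differentiable_D[OF rep_isometry[OF at] in_dom[OF c d]] rep_dom_open[OF at] in_dom[OF c d]])
      (rule differential_coord_field[OF at, symmetric])
qed

lemma second_fund_tangent:
  assumes p: "p \<in> points M" and u: "u \<in> tangent_space M p"
  shows "B p u v \<in> tangent_space N (\<phi> p)"
  unfolding second_fund_def Let_def
  by (intro N.tangent_diff differential_tangent[OF p] pullback_conn_tangent[OF M.chart_at[OF p] u]
      differential_coord_field_differentiable[OF M.chart_at[OF p]]) (rule differential_tangent)

text \<open>In the chart used by the definition the extended field has constant coordinates, so its
  derivative vanishes and the Levi-Civita term reduces to a Christoffel term.\<close>

lemma second_fund_chart_at:
  assumes p: "p \<in> points M" and u: "u \<in> tangent_space M p" and d: "d \<in> charts_at N (\<phi> p)"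
  defines "c \<equiv> chart_at M p"
  shows "B p u v d = sff (M.\<gamma> c) (N.\<gamma> d) (rep c d) (snd c p) (u c) (v c)"
proof -
  have c: "c \<in> charts_at M p" unfolding c_def by (rule M.chart_at[OF p])
  have at: "c \<in> atlas M" "d \<in> atlas N" using c d M.charts_atD N.charts_atD by auto
  define Y where "Y = (\<lambda>q. coord_vec M c q (v c))"
  have "pullback_conn M N \<phi> p u (\<lambda>q. differential M N \<phi> q (Y q)) d
      = cov (N.\<gamma> d) (rep c d) (\<lambda>x. D (rep c d) x (v c)) (snd c p) (u c)"
    unfolding Y_def pullback_conn_eq[where V = "\<lambda>q. differential M N \<phi> q (coord_vec M c q (v c))",
        OF c d u differential_coord_field_differentiable[OF c d]]
    by (rule fun_cong[OF cov_cong[OF rep_dom_open[OF at] in_dom[OF c d]]])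
      (simp_all add: differential_coord_field[OF at])
  moreover have "differential M N \<phi> p (levi_civita M p u Y) d
      = D (rep c d) (snd c p) (chris (M.\<gamma> c) (snd c p) (u c) (v c))"
  proof -
    have Y: "Y (chart_inv c x) c = v c" if xd: "x \<in> rep_dom c d" for x
    proof -
      obtain q where q: "x = snd c q" "c \<in> charts_at M q" by (rule rep_dom_cases[OF xd at])
      show ?thesis unfolding Y_def q(1) M.chart_inv_left[OF M.charts_atD[OF q(2)]] by (rule M.coord_vec_self[OF q(2)])
    qed
    have "D (\<lambda>x. Y (chart_inv c x) c) (snd c p) = D (\<lambda>x. v c) (snd c p)"
      by (rule D_cong_on[OF rep_dom_open[OF at] in_dom[OF c d]]) (rule Y)
    then have "dir_deriv M p u (\<lambda>q. Y q c) = 0"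
      by (simp add: dir_deriv_def Let_def c_def[symmetric] o_def)
    moreover have "Y p c = v c" by (simp add: Y_def M.coord_vec_self[OF c])
    ultimately have "levi_civita M p u Y c = chris (M.\<gamma> c) (snd c p) (u c) (v c)"
      using c by (simp add: levi_civita_def christoffel_def chris_def koszul_def)
    then show ?thesis using d
      by (simp add: differential_def dir_deriv_def Let_def c_def[symmetric] rep_def)
  qed
  ultimately show ?thesis
    by (simp add: second_fund_def Let_def c_def[symmetric] Y_def sff_def)
qed

text \<open>Passing to an arbitrary chart is essential for differentiating the tension field: near
  \<open>p\<close> one chart must be kept fixed, while \<open>chart_at\<close> may change with the
  point.\<close>

lemma second_fund_eq:
  assumes c: "c \<in> charts_at M p" and d: "d \<in> charts_at N (\<phi> p)"
    and u: "u \<in> tangent_space M p" and v: "v \<in> tangent_space M p"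
  shows "B p u v d = sff (M.\<gamma> c) (N.\<gamma> d) (rep c d) (snd c p) (u c) (v c)"
proof -
  have p: "p \<in> points M" by (rule M.charts_at_points[OF c])
  define c0 where "c0 = chart_at M p"
  have c0: "c0 \<in> charts_at M p" unfolding c0_def by (rule M.chart_at[OF p])
  have at: "c \<in> atlas M" "c0 \<in> atlas M" "d \<in> atlas N" using c c0 d M.charts_atD N.charts_atD by auto
  \<comment> \<open>The points at which \<open>c0\<close>, \<open>c\<close> and \<open>d\<close> are
    all available; over them the transition map lands in the domain of
    \<open>rep c d\<close>.\<close>
  define W where "W = {q \<in> fst c. \<phi> q \<in> fst d} \<inter> fst c0"
  define S where "S = snd c0 ` W"
  have S: "open S" unfolding S_def
    by (rule M.chart_open[OF at(2)]) (auto simp: W_def rep_dom_openin M.chart_openin at)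
  have sub: "S \<subseteq> snd c0 ` (fst c0 \<inter> fst c)" by (auto simp: S_def W_def)
  have x: "snd c0 p \<in> S" using c c0 d by (auto simp: S_def W_def charts_at_def)
  interpret T: local_isometry "snd c0 ` (fst c0 \<inter> fst c)" "M.\<gamma> c0" "snd c ` fst c" "M.\<gamma> c" "transition c0 c"
    by (rule M.trans_isometry[OF at(2,1)])
  interpret f: local_isometry "rep_dom c d" "M.\<gamma> c" "snd d ` fst d" "N.\<gamma> d" "rep c d"
    by (rule rep_isometry[OF at(1,3)])
  have "local_isometry S (M.\<gamma> c0) (rep_dom c d) (M.\<gamma> c) (transition c0 c)"
  proof
    show "metric_field S (M.\<gamma> c0)" by (rule metric_field_subset[OF T.g S sub])
    show "smooth_on S (transition c0 c)" by (rule smooth_on_subset[OF T.smooth sub])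
    show "transition c0 c x \<in> rep_dom c d" if "x \<in> S" for x
      using that M.chart_inv_left[OF at(2)] by (auto simp: S_def W_def rep_dom_def)
  qed (use T.iso sub f.g in auto)
  then have "sff (M.\<gamma> c0) (N.\<gamma> d) (rep c0 d) (snd c0 p) (u c0) (v c0)
    = sff (M.\<gamma> c) (N.\<gamma> d) (rep c d) (transition c0 c (snd c0 p)) (D (transition c0 c) (snd c0 p) (u c0)) (D (transition c0 c) (snd c0 p) (v c0))"
    by (rule sff_reparametrize[OF _ f.local_isometry_axioms _ x M.trans_surj[OF c0 c]])
      (auto simp: S_def W_def rep_def M.chart_inv_left at)
  then show ?thesis
    using second_fund_chart_at[OF p u d, of v]
    by (simp only: c0_def[symmetric] M.trans_apply[OF c0] M.tangent_trans[OF u c0 c, symmetric] M.tangent_trans[OF v c0 c, symmetric])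
qed

lemma tension_eq:
  assumes c: "c \<in> charts_at M p" and d: "d \<in> charts_at N (\<phi> p)"
  shows "\<tau> p d = trace_sff (M.\<gamma> c) (N.\<gamma> d) (rep c d) (snd c p)"
proof -
  have p: "p \<in> points M" by (rule M.charts_at_points[OF c])
  have at: "c \<in> atlas M" "d \<in> atlas N" using c d M.charts_atD N.charts_atD by auto
  note on = M.onb_tangent[OF p]
  note mf = M.metric_field_chart[OF at(1)]
  have x: "snd c p \<in> snd c ` fst c" using M.charts_atD(2)[OF c] by blast
  have "\<tau> p d = (\<Sum>i\<in>UNIV. sff (M.\<gamma> c) (N.\<gamma> d) (rep c d) (snd c p) (onb M p i c) (onb M p i c))"
    unfolding tension_def second_fund_eq[OF c d on on] ..
  also have "\<dots> = trace_sff (M.\<gamma> c) (N.\<gamma> d) (rep c d) (snd c p)"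
    unfolding trace_sff_def
  proof (rule trace_orthonormal[OF mf x _ local_isometry.sff_bilinear[OF rep_isometry[OF at] in_dom[OF c d]]])
    show "M.\<gamma> c (snd c p) (onb M p i c) (onb M p j c) = (if i = j then 1 else 0)" for i j
      using M.metric_eq[OF on on c] M.onb_orthonormal[OF p] by simp
  qed
  finally show ?thesis .
qed

lemma tension_tangent: "p \<in> points M \<Longrightarrow> \<tau> p \<in> tangent_space N (\<phi> p)"
  unfolding tension_def by (intro N.tangent_sum second_fund_tangent M.onb_tangent)

lemma tension_coord:
  assumes at: "c \<in> atlas M" "d \<in> atlas N" and x: "x \<in> rep_dom c d"
  shows "\<tau> (chart_inv c x) d = trace_sff (M.\<gamma> c) (N.\<gamma> d) (rep c d) x"
proof -
  obtain q where q: "x = snd c q" "c \<in> charts_at M q" "d \<in> charts_at N (\<phi> q)"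
    by (rule rep_dom_cases[OF x at])
  show ?thesis
    by (simp add: q(1) M.chart_inv_left[OF M.charts_atD[OF q(2)]] tension_eq[OF q(2,3)])
qed

lemma tension_differentiable:
  assumes c: "c \<in> charts_at M p" and d: "d \<in> charts_at N (\<phi> p)"
  shows "(\<lambda>x. \<tau> (chart_inv c x) d) differentiable (at (snd c p))"
proof -
  have at: "c \<in> atlas M" "d \<in> atlas N" using c d M.charts_atD N.charts_atD by auto
  show ?thesis
    by (rule differentiable_transform_open[OF local_isometry.trace_sff_differentiable[OF rep_isometry[OF at] in_dom[OF c d]] rep_dom_open[OF at] in_dom[OF c d]])
      (rule tension_coord[OF at, symmetric])
qed

lemma nabla_tension_tangent:
  assumes p: "p \<in> points M" and u: "u \<in> tangent_space M p"
  shows "nabla_tension M N \<phi> p u \<in> tangent_space N (\<phi> p)"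
  unfolding nabla_tension_def
  by (rule pullback_conn_tangent[OF M.chart_at[OF p] u tension_tangent tension_differentiable[OF M.chart_at[OF p]]])

text \<open>\<open>D_cov_trace_sff\<close> carried to the manifold. Both sides may be read in one
  pair of charts because all vectors involved are known to be tangent.\<close>

lemma metric_differential_nabla_tension:
  assumes p: "p \<in> points M" and X: "X \<in> tangent_space M p" and Y: "Y \<in> tangent_space M p"
  shows "metric N (\<phi> p) (differential M N \<phi> p X) (nabla_tension M N \<phi> p Y) = - metric N (\<phi> p) (B p X Y) (\<tau> p)"
proof -
  define c d where "c = chart_at M p" and "d = chart_at N (\<phi> p)"
  have c: "c \<in> charts_at M p" and d: "d \<in> charts_at N (\<phi> p)"
    unfolding c_def d_def by (rule M.chart_at[OF p] N.chart_at[OF map_points[OF p]])+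
  have at: "c \<in> atlas M" "d \<in> atlas N" using c d M.charts_atD N.charts_atD by auto
  interpret f: local_isometry "rep_dom c d" "M.\<gamma> c" "snd d ` fst d" "N.\<gamma> d" "rep c d"
    by (rule rep_isometry[OF at])
  note x = in_dom[OF c d]
  have "nabla_tension M N \<phi> p Y d = cov (N.\<gamma> d) (rep c d) (trace_sff (M.\<gamma> c) (N.\<gamma> d) (rep c d)) (snd c p) (Y c)"
    unfolding nabla_tension_def pullback_conn_eq[where V = \<tau>, OF c d Y tension_differentiable[OF c d]]
    by (rule fun_cong[OF cov_cong[OF rep_dom_open[OF at] x]]) (simp_all add: tension_coord[OF at])
  then show ?thesis
    using f.D_cov_trace_sff[OF x, of "X c" "Y c"]
    by (simp add: N.metric_eq[OF differential_tangent[OF p] nabla_tension_tangent[OF p Y] d]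
        N.metric_eq[OF second_fund_tangent[OF p X] tension_tangent[OF p] d] rep_apply[OF c]
        differential_eq[OF c d X] second_fund_eq[OF c d X Y] tension_eq[OF c d] f.sff_sym[OF x, of "X c" "Y c"])
qed

lemma second_fund_sym:
  assumes p: "p \<in> points M" and X: "X \<in> tangent_space M p" and Y: "Y \<in> tangent_space M p"
  shows "metric N (\<phi> p) (B p X Y) (\<tau> p) = metric N (\<phi> p) (B p Y X) (\<tau> p)"
proof -
  note c = M.chart_at[OF p] and d = N.chart_at[OF map_points[OF p]]
  show ?thesis
    using local_isometry.sff_sym[OF rep_isometry[OF M.charts_atD(1)[OF c] N.charts_atD(1)[OF d]] in_dom[OF c d]]
    by (simp add: N.metric_eq[OF second_fund_tangent[OF p] tension_tangent[OF p] d] X Y second_fund_eq[OF c d])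
qed

section \<open>The stress-energy tensor and its trace\<close>

lemma tension_norm_sq:
  "p \<in> points M \<Longrightarrow> (tension_norm M N \<phi> p)\<^sup>2 = metric N (\<phi> p) (\<tau> p) (\<tau> p)"
  unfolding tension_norm_def by (simp add: N.metric_nonneg map_points tension_tangent)

lemma trace_second_fund:
  assumes p: "p \<in> points M"
  shows "(\<Sum>i\<in>UNIV. metric N (\<phi> p) (B p (onb M p i) (onb M p i)) (\<tau> p)) = (tension_norm M N \<phi> p)\<^sup>2"
proof -
  have "metric N (\<phi> p) (\<lambda>d. \<Sum>i\<in>UNIV. B p (onb M p i) (onb M p i) d) (\<tau> p)
      = (\<Sum>i\<in>UNIV. metric N (\<phi> p) (B p (onb M p i) (onb M p i)) (\<tau> p))"
    by (intro N.metric_sum_left map_points second_fund_tangent tension_tangent M.onb_tangent p)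
  then show ?thesis by (simp add: tension_norm_sq[OF p] tension_def[symmetric])
qed

text \<open>The trace term of S_2 equals minus the squared norm of the tension field and so turns
  the coefficient 1/2 into -1/2; the two mixed terms both give the pairing of \<open>B\<close> with
  \<open>\<tau>\<close>.\<close>

lemma stress_energy2_eq:
  assumes p: "p \<in> points M" and X: "X \<in> tangent_space M p" and Y: "Y \<in> tangent_space M p"
  shows "stress_energy2 M N \<phi> p X Y
    = 2 * metric N (\<phi> p) (B p X Y) (\<tau> p) - 1/2 * (tension_norm M N \<phi> p)\<^sup>2 * metric M p X Y"
  unfolding stress_energy2_def
  by (simp add: metric_differential_nabla_tension[OF p] M.onb_tangent[OF p] X Y sum_negf trace_second_fund[OF p]
      second_fund_sym[OF p Y X])

text \<open>Summing over the orthonormal basis, the pairing of \<open>B\<close> with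
  \<open>\<tau>\<close> contributes the squared norm twice and the metric term subtracts
  \<open>m/2\<close> times it; the result is doubled to clear the fraction.\<close>

lemma trace_stress_energy2:
  assumes p: "p \<in> points M"
    and eq: "\<And>X Y. X \<in> tangent_space M p \<Longrightarrow> Y \<in> tangent_space M p \<Longrightarrow> stress_energy2 M N \<phi> p X Y = l * metric M p X Y"
  shows "(4 - real CARD('m)) * (tension_norm M N \<phi> p)\<^sup>2 = 2 * real CARD('m) * l"
proof -
  have "2 * metric N (\<phi> p) (B p (onb M p i) (onb M p i)) (\<tau> p) = l + 1/2 * (tension_norm M N \<phi> p)\<^sup>2" for i
    using eq[OF M.onb_tangent[OF p] M.onb_tangent[OF p], of i i]
    by (simp add: stress_energy2_eq[OF p] M.onb_tangent[OF p] M.onb_orthonormal[OF p])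
  then have "(\<Sum>i\<in>(UNIV::'m set). 2 * metric N (\<phi> p) (B p (onb M p i) (onb M p i)) (\<tau> p))
      = (\<Sum>i\<in>(UNIV::'m set). l + 1/2 * (tension_norm M N \<phi> p)\<^sup>2)" by simp
  then show ?thesis
    unfolding sum_distrib_left[symmetric] trace_second_fund[OF p] by (simp add: algebra_simps)
qed

lemma stress_energy2_const_iff:
  "(\<exists>l::real. \<forall>p\<in>points M. \<forall>X\<in>tangent_space M p. \<forall>Y\<in>tangent_space M p.
      stress_energy2 M N \<phi> p X Y = l * metric M p X Y)
   \<longleftrightarrow> pseudo_umbilical M N \<phi> \<and>
       (CARD('m) \<noteq> 4 \<longrightarrow> (\<exists>C. \<forall>p\<in>points M. tension_norm M N \<phi> p = C))"
proof
  let ?m = "real CARD('m)"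
  have m: "?m > 0" by simp
  {
    assume "\<exists>l::real. \<forall>p\<in>points M. \<forall>X\<in>tangent_space M p. \<forall>Y\<in>tangent_space M p.
      stress_energy2 M N \<phi> p X Y = l * metric M p X Y"
    then obtain l where l: "\<And>p X Y. p \<in> points M \<Longrightarrow> X \<in> tangent_space M p \<Longrightarrow> Y \<in> tangent_space M p
      \<Longrightarrow> stress_energy2 M N \<phi> p X Y = l * metric M p X Y" by blast
    have tr: "(4 - ?m) * (tension_norm M N \<phi> p)\<^sup>2 = 2 * ?m * l" if "p \<in> points M" for p
      using trace_stress_energy2[OF that l[OF that]] by blast
    have "metric N (\<phi> p) (B p X Y) (\<tau> p) = 1 / ?m * (tension_norm M N \<phi> p)\<^sup>2 * metric M p X Y"
      if p: "p \<in> points M" and X: "X \<in> tangent_space M p" and Y: "Y \<in> tangent_space M p" for p X Y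
    proof -
      define t where "t = (tension_norm M N \<phi> p)\<^sup>2"
      \<comment> \<open>The trace identity is used at the same point \<open>p\<close> to eliminate
        \<open>l\<close>, so pseudo-umbilicity follows in every dimension, including 4.\<close>
      have "l = (4 - ?m) * t / (2 * ?m)" using tr[OF p] m by (simp add: t_def field_simps)
      moreover have "2 * metric N (\<phi> p) (B p X Y) (\<tau> p) = (l + t / 2) * metric M p X Y"
        using l[OF p X Y] by (simp add: stress_energy2_eq[OF p X Y] t_def algebra_simps)
      moreover have "(4 - ?m) * t / (2 * ?m) + t / 2 = 2 * t / ?m" using m by (simp add: field_simps)
      ultimately show ?thesis by (simp add: t_def)
    qed
    then have "pseudo_umbilical M N \<phi>" unfolding pseudo_umbilical_def by blast
    moreover have "\<exists>C. \<forall>p\<in>points M. tension_norm M N \<phi> p = C" if "CARD('m) \<noteq> 4"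
    proof (intro exI ballI)
      fix p assume p: "p \<in> points M"
      have "tension_norm M N \<phi> p \<ge> 0"
        by (simp add: tension_norm_def N.metric_nonneg map_points tension_tangent p)
      \<comment> \<open>Only here is \<open>m \<noteq> 4\<close> needed: the factor
        \<open>4 - m\<close> of the trace identity must be divided out.\<close>
      moreover have "(tension_norm M N \<phi> p)\<^sup>2 = 2 * ?m * l / (4 - ?m)"
        using tr[OF p] that by (simp add: field_simps)
      ultimately show "tension_norm M N \<phi> p = sqrt (2 * ?m * l / (4 - ?m))"
        by (metis real_sqrt_unique)
    qed
    ultimately show "pseudo_umbilical M N \<phi> \<and>
       (CARD('m) \<noteq> 4 \<longrightarrow> (\<exists>C. \<forall>p\<in>points M. tension_norm M N \<phi> p = C))" by blast
  next
    assume R: "pseudo_umbilical M N \<phi> \<and>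
       (CARD('m) \<noteq> 4 \<longrightarrow> (\<exists>C. \<forall>p\<in>points M. tension_norm M N \<phi> p = C))"
    have S: "stress_energy2 M N \<phi> p X Y = (2 / ?m - 1/2) * (tension_norm M N \<phi> p)\<^sup>2 * metric M p X Y"
      if "p \<in> points M" "X \<in> tangent_space M p" "Y \<in> tangent_space M p" for p X Y
      using R that by (simp add: stress_energy2_eq pseudo_umbilical_def left_diff_distrib)
    obtain C where "\<And>p. p \<in> points M \<Longrightarrow> CARD('m) \<noteq> 4 \<Longrightarrow> tension_norm M N \<phi> p = C"
      using R by blast
    then show "\<exists>l::real. \<forall>p\<in>points M. \<forall>X\<in>tangent_space M p. \<forall>Y\<in>tangent_space M p.
      stress_energy2 M N \<phi> p X Y = l * metric M p X Y"
      \<comment> \<open>For \<open>m = 4\<close> the coefficient \<open>2 / m - 1/2\<close>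
        vanishes, so the witness is 0 whatever \<open>C\<close> is; otherwise \<open>C\<close> is
        the constant norm.\<close>
      by (intro exI[of _ "(2 / ?m - 1/2) * C\<^sup>2"]) (cases "CARD('m) = 4"; simp add: S)
  }
qed

end

theorem theorem5p3:
  fixes M :: "('a, 'm::finite) manifold"
    and N :: "('b, 'n::finite) manifold"
    and \<phi> :: "'a \<Rightarrow> 'b"
  assumes "riemannian_manifold M" and "riemannian_manifold N"
    and "riemannian_immersion M N \<phi>"
    and "\<not> minimal M N \<phi>"
  shows "(\<exists>l::real. \<forall>p\<in>points M. \<forall>X\<in>tangent_space M p. \<forall>Y\<in>tangent_space M p.
            stress_energy2 M N \<phi> p X Y = l * metric M p X Y)
     \<longleftrightarrow> pseudo_umbilical M N \<phi> \<and>
          (CARD('m) \<noteq> 4 \<longrightarrow> (\<exists>C. \<forall>p\<in>points M. tension_norm M N \<phi> p = C))"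
proof -
  interpret immersion M N \<phi>
    using assms(1-3) by (intro immersion.intro immersion_axioms.intro riemannian_locale)
  show ?thesis by (rule stress_energy2_const_iff)
qed

end
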